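(* Let $\Omega,\ell,Q,f,\omega,\bar\varsigma,\varphi$ satisfy the standing assumptions listed in the context, and assume $\bar\varsigma\in(0,\infty)$. Let $\{(u_\varepsilon,v_\varepsilon)\}_{\varepsilon>0}\subset L^1(\Omega,\mathbb R^2)$ be such that $$\sup_{\varepsilon>0}\big(\mathcal F_\varepsilon(u_\varepsilon,v_\varepsilon)+\|u_\varepsilon\|_{L^1(\Omega)}\big)<\infty.$$ Then there are a sequence $\{\varepsilon_k\}_{k\in\mathbb N}$ with $\varepsilon_k\to0^+$ and $u\in L^1\cap GBV(\Omega)$ such that $(u_{\varepsilon_k},v_{\varepsilon_k})\to(u,1)$ $\mathcal L^1$-a.e. on $\Omega$. If, moreover, $(u_\varepsilon)_\varepsilon$ is equi-integrable, then $u_{\varepsilon_k}\to u$ in $L^1(\Omega)$.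
   Context: Standing assumptions. $\Omega\subset\mathbb R$ is a bounded open interval. $\ell,Q\in C^0([0,1],[0,\infty))$, $\ell(1)=1$, $\ell^{-1}(\{0\})=Q^{-1}(\{0\})=\{0\}$, $Q$ is non-decreasing in a right neighbourhood of $0$, and $f(t):=\big(\ell(t)/Q(1-t)\big)^{1/2}$, $t\in[0,1)$, is non-decreasing in a left neighbourhood of $t=1$. $\omega\in C^0([0,1],[0,\infty))$, $\omega^{-1}(\{0\})=\{0\}$, and the limit $\bar\varsigma:=\lim_{t\to0^+}(\omega(t)/Q(t))^{1/2}\in[0,\infty]$ exists. $\varphi\in C^0([0,\infty))$ is non-negative and non-decreasing, $\varphi(\infty):=\lim_{t\to\infty}\varphi(t)\in(0,\infty)$, $\varphi^{-1}(\{0\})=\{0\}$, and $\varphi$ is right-differentiable at $0$ with $\varphi'(0^+)\in(0,\infty)$. Phase-field functionals. For $\varepsilon>0$, $\mathcal F_\varepsilon:L^1(\Omega,\mathbb R^2)\to[0,\infty]$ is $$\mathcal F_\varepsilon(u,v):=\int_\Omega\Big(\varphi(\varepsilon f^2(v))|u'|^2+\frac{\omega(1-v)}{4\varepsilon}+\varepsilon|v'|^2\Big)dx$$ if $(u,v)\in H^1(\Omega,\mathbb R\times[0,1])$, and $\infty$ otherwise; $t\mapsto\varphi(\varepsilon f^2(t))$ is extended to $t=1$ with value $\varphi(\infty)$. $GBV(\Omega)$ is the space of generalized functions of bounded variation. *)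

theory Defs
  imports "HOL-Analysis.Analysis"
begin

text \<open>Elements of Lebesgue and Sobolev spaces on a set \<open>\<Omega>\<close> are represented by functions on
  the whole line; their values outside \<open>\<Omega>\<close> are irrelevant.\<close>

definition L1 :: "real set \<Rightarrow> (real \<Rightarrow> real) set" where
  "L1 \<Omega> = {u. integrable (lebesgue_on \<Omega>) u}"

definition L1_norm :: "real set \<Rightarrow> (real \<Rightarrow> real) \<Rightarrow> ennreal" where
  "L1_norm \<Omega> u = (\<integral>\<^sup>+x. ennreal \<bar>u x\<bar> \<partial>lebesgue_on \<Omega>)"

definition L2 :: "real set \<Rightarrow> (real \<Rightarrow> real) set" where
  "L2 \<Omega> = {u \<in> borel_measurable (lebesgue_on \<Omega>). integrable (lebesgue_on \<Omega>) (\<lambda>x. (u x)\<^sup>2)}"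

definition L1_loc :: "real set \<Rightarrow> (real \<Rightarrow> real) set" where
  "L1_loc \<Omega> = {u. \<forall>K. compact K \<and> K \<subseteq> \<Omega> \<longrightarrow> integrable (lebesgue_on K) u}"

text \<open>The space \<open>C\<^sup>1\<^sub>c(U)\<close> of test functions, extended by zero to the whole line.\<close>

definition C1c :: "real set \<Rightarrow> (real \<Rightarrow> real) set" where
  "C1c U = {\<psi>. \<psi> C1_differentiable_on UNIV \<and>
                compact (closure {x. \<psi> x \<noteq> 0}) \<and> closure {x. \<psi> x \<noteq> 0} \<subseteq> U}"

definition has_weak_deriv :: "real set \<Rightarrow> (real \<Rightarrow> real) \<Rightarrow> (real \<Rightarrow> real) \<Rightarrow> bool" where
  "has_weak_deriv \<Omega> u g \<longleftrightarrow> u \<in> L1_loc \<Omega> \<and> g \<in> L1_loc \<Omega> \<and>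
     (\<forall>\<psi>\<in>C1c \<Omega>. (\<integral>x. u x * deriv \<psi> x \<partial>lebesgue_on \<Omega>) = - (\<integral>x. g x * \<psi> x \<partial>lebesgue_on \<Omega>))"

definition H1 :: "real set \<Rightarrow> (real \<Rightarrow> real) set" where
  "H1 \<Omega> = {u \<in> L2 \<Omega>. \<exists>g\<in>L2 \<Omega>. has_weak_deriv \<Omega> u g}"

text \<open>A representative of the weak derivative of \<open>u \<in> H\<^sup>1(\<Omega>)\<close>; it is unique up to null sets.\<close>

definition weak_deriv :: "real set \<Rightarrow> (real \<Rightarrow> real) \<Rightarrow> real \<Rightarrow> real" where
  "weak_deriv \<Omega> u = (SOME g. g \<in> L2 \<Omega> \<and> has_weak_deriv \<Omega> u g)"

definition total_variation :: "real set \<Rightarrow> (real \<Rightarrow> real) \<Rightarrow> ereal" where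
  "total_variation V w =
     (SUP \<psi>\<in>{\<psi> \<in> C1c V. \<forall>x. \<bar>\<psi> x\<bar> \<le> 1}. ereal (\<integral>x. w x * deriv \<psi> x \<partial>lebesgue_on V))"

definition BV_loc :: "real set \<Rightarrow> (real \<Rightarrow> real) set" where
  "BV_loc \<Omega> = {w \<in> L1_loc \<Omega>.
     \<forall>V. open V \<and> compact (closure V) \<and> closure V \<subseteq> \<Omega> \<longrightarrow> total_variation V w < \<infinity>}"

definition GBV :: "real set \<Rightarrow> (real \<Rightarrow> real) set" where
  "GBV \<Omega> = {u \<in> borel_measurable (lebesgue_on \<Omega>).
     \<forall>M>0. (\<lambda>x. max (- M) (min M (u x))) \<in> BV_loc \<Omega>}"

text \<open>On sets of finite measure, to which this definition is applied, no tightness condition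
  is needed.\<close>

definition equi_integrable :: "real set \<Rightarrow> 'i set \<Rightarrow> ('i \<Rightarrow> real \<Rightarrow> real) \<Rightarrow> bool" where
  "equi_integrable \<Omega> I u \<longleftrightarrow> (\<forall>i\<in>I. u i \<in> L1 \<Omega>) \<and>
     (\<forall>\<eta>>0. \<exists>\<delta>>0. \<forall>A\<in>sets lebesgue. A \<subseteq> \<Omega> \<and> emeasure lebesgue A < ennreal \<delta> \<longrightarrow>
        (\<forall>i\<in>I. L1_norm A (u i) < ennreal \<eta>))"

text \<open>Only meaningful for \<open>t \<in> [0,1)\<close>: at \<open>t = 1\<close> the denominator vanishes.\<close>

definition f_deg :: "(real \<Rightarrow> real) \<Rightarrow> (real \<Rightarrow> real) \<Rightarrow> real \<Rightarrow> real" where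
  "f_deg ell Q t = sqrt (ell t / Q (1 - t))"

text \<open>The map \<open>t \<mapsto> \<phi>(\<epsilon> f\<^sup>2(t))\<close>, extended to \<open>t = 1\<close> by \<open>\<phi>(\<infinity>)\<close>.\<close>

definition phi_f ::
  "(real \<Rightarrow> real) \<Rightarrow> (real \<Rightarrow> real) \<Rightarrow> (real \<Rightarrow> real) \<Rightarrow> real \<Rightarrow> real \<Rightarrow> real" where
  "phi_f \<phi> ell Q \<epsilon> t = (if t = 1 then Lim at_top \<phi> else \<phi> (\<epsilon> * (f_deg ell Q t)\<^sup>2))"

definition phase_field ::
  "real set \<Rightarrow> (real \<Rightarrow> real) \<Rightarrow> (real \<Rightarrow> real) \<Rightarrow> (real \<Rightarrow> real) \<Rightarrow> (real \<Rightarrow> real) \<Rightarrow> real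
     \<Rightarrow> (real \<Rightarrow> real) \<Rightarrow> (real \<Rightarrow> real) \<Rightarrow> ennreal" where
  "phase_field \<Omega> \<phi> ell Q \<omega> \<epsilon> u v =
     (if u \<in> H1 \<Omega> \<and> v \<in> H1 \<Omega> \<and> (AE x in lebesgue_on \<Omega>. v x \<in> {0..1})
      then \<integral>\<^sup>+x. ennreal (phi_f \<phi> ell Q \<epsilon> (v x) * (weak_deriv \<Omega> u x)\<^sup>2
               + \<omega> (1 - v x) / (4 * \<epsilon>) + \<epsilon> * (weak_deriv \<Omega> v x)\<^sup>2) \<partial>lebesgue_on \<Omega>
      else \<infinity>)"

end

theory Submission
  imports Defs "HOL-Probability.Probability"
begin

text \<open>Let \<open>\<theta>\<close> be a Lipschitz cutoff that vanishes for small \<open>t\<close> and equals \<open>1\<close> for \<open>t \<ge> 1/2\<close>, and let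
  \<open>\<tau>\<close> be bounded and 1-Lipschitz. The function \<open>\<theta>(v\<^sub>\<epsilon>) \<tau>(u\<^sub>\<epsilon>)\<close> has variation bounded uniformly in
  \<open>\<epsilon>\<close>: where \<open>v\<^sub>\<epsilon> \<le> 3/4\<close> the potential is bounded away from \<open>0\<close>, so that
  \<open>|v\<^sub>\<epsilon>'| \<lesssim> \<omega>(1 - v\<^sub>\<epsilon>)/\<epsilon> + \<epsilon>|v\<^sub>\<epsilon>'|\<^sup>2\<close>, and where \<open>v\<^sub>\<epsilon> \<ge> 1/4\<close> the bound
  \<open>\<phi>(\<epsilon>f\<^sup>2) \<ge> c min(1, \<epsilon>/\<omega>(1 - v\<^sub>\<epsilon>))\<close>, which rests on \<open>\<omega> \<sim> Q\<close>, gives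
  \<open>|u\<^sub>\<epsilon>'| \<lesssim> \<phi>(\<epsilon>f\<^sup>2)|u\<^sub>\<epsilon>'|\<^sup>2 + \<omega>(1 - v\<^sub>\<epsilon>)/\<epsilon> + 1\<close>. Helly's theorem with \<open>\<tau> = arctan\<close> then yields a
  subsequence along which \<open>arctan u\<^sub>\<epsilon>\<close> converges almost everywhere, because \<open>v\<^sub>\<epsilon> \<rightarrow> 1\<close>; by Fatou
  \<open>liminf |u\<^sub>\<epsilon>| < \<infinity>\<close>, so \<open>u\<^sub>\<epsilon>\<close> itself converges. With \<open>\<tau>\<close> the truncation at height \<open>M\<close>, lower
  semicontinuity of the variation shows that the limit is in \<open>GBV\<close>.\<close>

section \<open>Primitives of integrable functions\<close>

text \<open>All estimates concern increments of absolutely continuous representatives; compositions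
  with \<open>cutoff\<close> and \<tau> are never differentiated. A bound of a derivative by an
  integrable density \<open>H\<close> takes the form
  \<open>|F t - F s| \<le> primitive H t - primitive H s\<close>, and this one inequality serves
  twice: it makes \<open>primitive H\<close> and \<open>primitive H - F\<close> monotone, as Helly's
  theorem demands, and it bounds the integral of \<open>F\<close> against the derivative of a test
  function by the integral of \<open>H\<close>. The obstacle is that the energy controls neither
  derivative everywhere: that of \<open>u\<close> may escape near \<open>v = 0\<close>, where
  \<open>ell\<close> vanishes, and that of \<open>v\<close> near \<open>v = 1\<close>, where the
  potential vanishes. The ranges \<open>v \<ge> 1/4\<close> and \<open>v \<le> 3/4\<close> overlap,
  and \<open>cutoff\<close> makes its whole transition inside the overlap, so each derivative is
  needed only where it is controlled. Compactness uses arctan instead of truncations because it is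
  bounded and injective at once: a single subsequence determines the limit of \<open>u\<close>, with
  no diagonal argument over truncation heights.\<close>

definition primitive :: "(real \<Rightarrow> real) \<Rightarrow> real \<Rightarrow> real" where
  "primitive g x = (\<integral>y. indicator {..x} y * g y \<partial>lborel)"

lemma integrable_indicator_times:
  fixes g :: "real \<Rightarrow> real"
  assumes "integrable lborel g" "A \<in> sets borel"
  shows "integrable lborel (\<lambda>y. indicator A y * g y)"
  using integrable_mult_indicator[of A lborel g] assms by simp

lemma primitive_diff:
  assumes g: "integrable lborel g" and "s \<le> t"
  shows "primitive g t - primitive g s = (\<integral>y. indicator {s<..t} y * g y \<partial>lborel)"
proof -
  have "primitive g t - primitive g s
      = (\<integral>y. indicator {..t} y * g y - indicator {..s} y * g y \<partial>lborel)"
    unfolding primitive_def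
    by (intro Bochner_Integration.integral_diff[symmetric] integrable_indicator_times g) auto
  also have "\<dots> = (\<integral>y. indicator {s<..t} y * g y \<partial>lborel)"
    using \<open>s \<le> t\<close> by (intro Bochner_Integration.integral_cong) (auto split: split_indicator)
  finally show ?thesis .
qed

text \<open>The pointwise bound is required only between \<open>s\<close> and \<open>t\<close>. This
  permits its use on short intervals on which a density defined by cases is known to be in one
  particular case.\<close>

lemma primitive_diff_le:
  assumes g: "integrable lborel g" and h: "integrable lborel h" and "s \<le> t"
    and le: "\<And>y. s < y \<Longrightarrow> y \<le> t \<Longrightarrow> \<bar>g y\<bar> \<le> h y"
  shows "\<bar>primitive g t - primitive g s\<bar> \<le> primitive h t - primitive h s"
proof -
  have "\<bar>primitive g t - primitive g s\<bar> \<le> (\<integral>y. indicator {s<..t} y * h y \<partial>lborel)"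
    unfolding primitive_diff[OF g \<open>s \<le> t\<close>] real_norm_def[symmetric]
    by (rule Bochner_Integration.integral_norm_bound_integral)
       (use le in \<open>auto intro!: integrable_indicator_times g h split: split_indicator\<close>)
  then show ?thesis
    by (simp add: primitive_diff[OF h \<open>s \<le> t\<close>])
qed

lemma primitive_mono:
  assumes "integrable lborel h" "\<And>y. 0 \<le> h y"
  shows "mono (primitive h)"
proof (rule monoI)
  fix s t :: real assume "s \<le> t"
  show "primitive h s \<le> primitive h t"
    using primitive_diff_le[OF _ assms(1) \<open>s \<le> t\<close>, of "\<lambda>_. 0"] assms(2) by (simp add: primitive_def)
qed

lemma primitive_bounds:
  assumes "integrable lborel h" "\<And>y. 0 \<le> h y"
  shows "0 \<le> primitive h x" "primitive h x \<le> (\<integral>y. h y \<partial>lborel)"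
proof -
  show "0 \<le> primitive h x"
    unfolding primitive_def by (rule Bochner_Integration.integral_nonneg) (simp add: assms)
  show "primitive h x \<le> (\<integral>y. h y \<partial>lborel)"
    unfolding primitive_def
    by (rule integral_mono) (use assms in \<open>auto intro!: integrable_indicator_times split: split_indicator\<close>)
qed

lemma primitive_add:
  assumes "integrable lborel g" "integrable lborel h"
  shows "primitive (\<lambda>y. g y + h y) x = primitive g x + primitive h x"
  unfolding primitive_def distrib_left
  by (intro Bochner_Integration.integral_add integrable_indicator_times assms) auto

lemma isCont_primitive:
  assumes g: "integrable lborel g"
  shows "isCont (primitive g) x"
proof (rule continuous_at_sequentiallyI)
  fix X :: "nat \<Rightarrow> real" assume X: "X \<longlonglongrightarrow> x"
  note [measurable] = borel_measurable_integrable[OF g]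
  show "(\<lambda>n. primitive g (X n)) \<longlonglongrightarrow> primitive g x"
    unfolding primitive_def
  proof (rule integral_dominated_convergence)
    show "integrable lborel (\<lambda>y. \<bar>g y\<bar>)" using g by simp
    show "AE y in lborel. (\<lambda>n. indicator {..X n} y * g y) \<longlonglongrightarrow> indicator {..x} y * g y"
      \<comment> \<open>At \<open>y = x\<close> the indicators oscillate if \<open>X\<close>
        approaches \<open>x\<close> from both sides, so this one point is discarded.\<close>
      using AE_lborel_singleton[of x]
    proof eventually_elim
      case (elim y)
      have "\<forall>\<^sub>F n in sequentially. indicator {..X n} y * g y = indicator {..x} y * g y"
      proof (cases "y < x")
        case True
        from order_tendstoD(1)[OF X this] show ?thesis
          by eventually_elim (use True in \<open>auto split: split_indicator\<close>)
      next
        case False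
        with elim have "x < y" by simp
        from order_tendstoD(2)[OF X this] show ?thesis
          by eventually_elim (use \<open>x < y\<close> in \<open>auto split: split_indicator\<close>)
      qed
      then show ?case by (rule tendsto_eventually)
    qed
  qed (auto split: split_indicator)
qed

section \<open>The cutoff in the phase variable and the variation of the cut-off product\<close>

definition cutoff :: "real \<Rightarrow> real" where
  "cutoff t = max 0 (min 1 (8 * t - 3))"

lemma continuous_on_cutoff [continuous_intros]:
  "continuous_on A f \<Longrightarrow> continuous_on A (\<lambda>x. cutoff (f x))"
  unfolding cutoff_def by (intro continuous_intros)

lemma cutoff_bounds: "0 \<le> cutoff t" "cutoff t \<le> 1"
  by (auto simp: cutoff_def)

lemma cutoff_eq_0: "t \<le> 3/8 \<Longrightarrow> cutoff t = 0"
  and cutoff_eq_1: "1/2 \<le> t \<Longrightarrow> cutoff t = 1"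
  by (auto simp: cutoff_def)

lemma cutoff_lipschitz: "\<bar>cutoff s - cutoff t\<bar> \<le> 8 * \<bar>s - t\<bar>"
  by (auto simp: cutoff_def max_def min_def abs_if)

text \<open>Formally \<open>H\<close> bounds the derivative given by the product and chain rules:
  \<open>8 * M\<close> is the Lipschitz constant of \<open>cutoff\<close> times the bound of \<tau>,
  and the derivative of \<open>U\<close> counts only where \<open>cutoff\<close> can be nonzero.
  Since \<tau> and \<open>cutoff\<close> are merely Lipschitz, the bound is proved for increments on
  short intervals and then glued.\<close>

lemma cutoff_product_variation:
  fixes \<tau> :: "real \<Rightarrow> real"
  assumes g: "integrable lborel g" and h: "integrable lborel h"
    and U: "\<And>x. U x = c + primitive g x" and V: "\<And>x. V x = d + primitive h x"
    and lip: "\<And>x y. \<bar>\<tau> x - \<tau> y\<bar> \<le> \<bar>x - y\<bar>" and bd: "\<And>x. \<bar>\<tau> x\<bar> \<le> M"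
    and H: "\<And>y. H y = (if V y \<le> 3/4 then 8 * M * \<bar>h y\<bar> else 0) + (if 1/4 \<le> V y then \<bar>g y\<bar> else 0)"
    and "s \<le> t"
  shows "\<bar>cutoff (V t) * \<tau> (U t) - cutoff (V s) * \<tau> (U s)\<bar> \<le> primitive H t - primitive H s"
proof -
  have M: "0 \<le> M" using bd[of 0] by linarith
  have contV: "isCont V x" for x
    unfolding V[abs_def] by (intro continuous_intros isCont_primitive h)
  then have [measurable]: "V \<in> borel_measurable borel"
    by (intro borel_measurable_continuous_onI continuous_at_imp_continuous_on) auto
  note [measurable] = borel_measurable_integrable[OF g] borel_measurable_integrable[OF h]
  define H1 where "H1 y = (if V y \<le> 3/4 then 8 * M * \<bar>h y\<bar> else 0)" for y
  define H2 where "H2 y = (if 1/4 \<le> V y then \<bar>g y\<bar> else 0)" for y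
  have [measurable]: "H1 \<in> borel_measurable borel" "H2 \<in> borel_measurable borel"
    unfolding H1_def[abs_def] H2_def[abs_def] by measurable
  have i1: "integrable lborel H1"
    by (rule Bochner_Integration.integrable_bound[of _ "\<lambda>y. 8 * M * \<bar>h y\<bar>"])
       (use h M in \<open>auto simp: H1_def\<close>)
  have i2: "integrable lborel H2"
    by (rule Bochner_Integration.integrable_bound[of _ "\<lambda>y. \<bar>g y\<bar>"])
       (use g in \<open>auto simp: H2_def\<close>)
  have H12: "primitive H x = primitive H1 x + primitive H2 x" for x
  proof -
    have "H = (\<lambda>y. H1 y + H2 y)" by (auto simp: fun_eq_iff H H1_def H2_def)
    then show ?thesis using primitive_add[OF i1 i2] by simp
  qed
  have m1: "primitive H1 x \<le> primitive H1 y" and m2: "primitive H2 x \<le> primitive H2 y"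
    if "x \<le> y" for x y
    using that M
    by (auto intro!: monoD[OF primitive_mono] i1 i2 simp: H1_def H2_def)
  from \<open>s \<le> t\<close> show ?thesis
  \<comment> \<open>The claim is additive over adjacent intervals, so bisection leaves only a
    neighbourhood of each point to be treated.\<close>
  proof (induction rule: Bolzano)
    case (trans a b c)
    then show ?case by linarith
  next
    case (local x)
    have "\<forall>\<^sub>F y in nhds x. dist (V y) (V x) < 1/16"
      using contV[of x] unfolding isCont_def tendsto_at_iff_tendsto_nhds
      by (rule tendstoD) simp
    then obtain e where e: "e > 0" "\<And>y. dist y x < e \<Longrightarrow> dist (V y) (V x) < 1/16"
      unfolding eventually_nhds_metric by blast
    show ?case
    proof (intro exI[of _ e] conjI allI impI; (elim conjE)?)
      fix a b assume ab: "a \<le> x" "x \<le> b" "b - a < e"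
      have near: "\<bar>V y - V x\<bar> < 1/16" if "a \<le> y" "y \<le> b" for y
        using e(2)[of y] ab that by (auto simp: dist_real_def)
      have "a \<le> b" using ab by simp
      have na: "\<bar>V a - V x\<bar> < 1/16" and nb: "\<bar>V b - V x\<bar> < 1/16"
        using near[of a] near[of b] \<open>a \<le> b\<close> by auto
      show "\<bar>cutoff (V b) * \<tau> (U b) - cutoff (V a) * \<tau> (U a)\<bar> \<le> primitive H b - primitive H a"
      \<comment> \<open>\<open>V\<close> varies by less than 1/16 here. Below 5/16 it stays under
        5/16 + 1/16 = 3/8, where \<open>cutoff\<close> is 0; otherwise it stays above 5/16 - 1/16 =
        1/4, so the \<open>g\<close> part of \<open>H\<close> is active. The later threshold 11/16
        works alike: up to it \<open>V\<close> stays under 3/4 and the \<open>h\<close> part is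
        active, above it \<open>V\<close> exceeds 5/8 and \<open>cutoff\<close> is 1.\<close>
      proof (cases "V x < 5/16")
        case True
        then have "cutoff (V a) = 0" "cutoff (V b) = 0" using na nb by (intro cutoff_eq_0; linarith)+
        then show ?thesis using m1[OF \<open>a \<le> b\<close>] m2[OF \<open>a \<le> b\<close>] H12 by simp
      next
        case False
        have "\<bar>U b - U a\<bar> \<le> primitive H2 b - primitive H2 a"
          unfolding U add_diff_cancel_left
        proof (rule primitive_diff_le[OF g i2 \<open>a \<le> b\<close>])
          fix y assume "a < y" "y \<le> b"
          with near[of y] False show "\<bar>g y\<bar> \<le> H2 y" by (auto simp: H2_def)
        qed
        with lip[of "U b" "U a"] have 2: "\<bar>\<tau> (U b) - \<tau> (U a)\<bar> \<le> primitive H2 b - primitive H2 a"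
          by linarith
        have 1: "M * \<bar>cutoff (V b) - cutoff (V a)\<bar> \<le> primitive H1 b - primitive H1 a"
        proof (cases "V x \<le> 11/16")
          case True
          have ih: "integrable lborel (\<lambda>y. 8 * M * h y)" using h by simp
          have p: "primitive (\<lambda>y. 8 * M * h y) x = 8 * M * primitive h x" for x
            unfolding primitive_def integral_mult_right_zero[symmetric]
            by (intro Bochner_Integration.integral_cong) auto
          have "\<bar>cutoff (V b) - cutoff (V a)\<bar> \<le> 8 * \<bar>V b - V a\<bar>"
            by (rule cutoff_lipschitz)
          then have "M * \<bar>cutoff (V b) - cutoff (V a)\<bar> \<le> M * (8 * \<bar>V b - V a\<bar>)"
            using M by (rule mult_left_mono)
          also have "\<dots> = \<bar>8 * M * (V b - V a)\<bar>" using M by (simp add: abs_mult)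
          also have "\<dots> = \<bar>primitive (\<lambda>y. 8 * M * h y) b - primitive (\<lambda>y. 8 * M * h y) a\<bar>"
            unfolding p V by (simp add: algebra_simps)
          also have "\<dots> \<le> primitive H1 b - primitive H1 a"
          proof (rule primitive_diff_le[OF ih i1 \<open>a \<le> b\<close>])
            fix y assume "a < y" "y \<le> b"
            with near[of y] True M show "\<bar>8 * M * h y\<bar> \<le> H1 y" by (auto simp: H1_def abs_mult)
          qed
          finally show ?thesis .
        next
          case False
          then have "cutoff (V a) = 1" "cutoff (V b) = 1" using na nb by (intro cutoff_eq_1; linarith)+
          then show ?thesis using m1[OF \<open>a \<le> b\<close>] by simp
        qed
        have "cutoff (V b) * \<tau> (U b) - cutoff (V a) * \<tau> (U a)
            = cutoff (V b) * (\<tau> (U b) - \<tau> (U a)) + (cutoff (V b) - cutoff (V a)) * \<tau> (U a)"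
          by (simp add: algebra_simps)
        also have "\<bar>\<dots>\<bar> \<le> cutoff (V b) * \<bar>\<tau> (U b) - \<tau> (U a)\<bar> + \<bar>cutoff (V b) - cutoff (V a)\<bar> * \<bar>\<tau> (U a)\<bar>"
          by (rule order_trans[OF abs_triangle_ineq]) (simp add: abs_mult cutoff_bounds)
        also have "\<dots> \<le> 1 * \<bar>\<tau> (U b) - \<tau> (U a)\<bar> + \<bar>cutoff (V b) - cutoff (V a)\<bar> * M"
          by (intro add_mono mult_right_mono mult_left_mono bd cutoff_bounds) auto
        also have "\<dots> \<le> primitive H b - primitive H a"
          using 1 2 unfolding H12 by (simp add: mult.commute)
        finally show ?thesis .
      qed
    qed (rule e(1))
  qed
qed

section \<open>Uniqueness, integration by parts and differentiation for primitives\<close>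

text \<open>The positive and negative parts of \<open>f\<close> are densities of two finite Borel
  measures. A vanishing primitive says that their distribution functions agree, so the measures
  agree and the two densities coincide almost everywhere. At every point one of the parts is zero,
  hence then both are.\<close>

lemma AE_zero_if_primitive_zero:
  assumes f: "integrable lborel f" and zero: "\<And>x. primitive f x = 0"
  shows "AE x in lborel. f x = 0"
proof -
  note [measurable] = borel_measurable_integrable[OF f]
  define P where "P = density lborel (\<lambda>x. ennreal (f x))"
  define N where "N = density lborel (\<lambda>x. ennreal (- f x))"
  have fin: "(\<integral>\<^sup>+x. ennreal (f x) \<partial>lborel) < \<infinity>" "(\<integral>\<^sup>+x. ennreal (- f x) \<partial>lborel) < \<infinity>"
  proof -
    have "(\<integral>\<^sup>+x. ennreal (norm (f x)) \<partial>lborel) < \<infinity>"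
      using f by (simp add: integrable_iff_bounded)
    moreover have "(\<integral>\<^sup>+x. ennreal (f x) \<partial>lborel) \<le> (\<integral>\<^sup>+x. ennreal (norm (f x)) \<partial>lborel)"
      "(\<integral>\<^sup>+x. ennreal (- f x) \<partial>lborel) \<le> (\<integral>\<^sup>+x. ennreal (norm (f x)) \<partial>lborel)"
      by (auto intro!: nn_integral_mono ennreal_leI)
    ultimately show "(\<integral>\<^sup>+x. ennreal (f x) \<partial>lborel) < \<infinity>" "(\<integral>\<^sup>+x. ennreal (- f x) \<partial>lborel) < \<infinity>"
      by auto
  qed
  have "finite_borel_measure P"
    unfolding P_def
    by (intro finite_borel_measure.intro finite_borel_measure_axioms.intro finite_measureI)
       (use fin in \<open>simp_all add: emeasure_density less_top\<close>)
  moreover have "finite_borel_measure N"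
    unfolding N_def
    by (intro finite_borel_measure.intro finite_borel_measure_axioms.intro finite_measureI)
       (use fin in \<open>simp_all add: emeasure_density less_top\<close>)
  moreover have "cdf P = cdf N"
  proof
    fix x
    have i: "integrable lborel (\<lambda>y. indicator {..x} y * max 0 (f y))"
      "integrable lborel (\<lambda>y. indicator {..x} y * max 0 (- f y))"
      using f by (auto intro!: integrable_indicator_times)
    have "emeasure P {..x} = ennreal (\<integral>y. indicator {..x} y * max 0 (f y) \<partial>lborel)"
      unfolding P_def using i
      by (subst nn_integral_eq_integral[symmetric])
         (auto simp: emeasure_density intro!: nn_integral_cong split: split_indicator)
    then have P: "cdf P x = (\<integral>y. indicator {..x} y * max 0 (f y) \<partial>lborel)"
      unfolding cdf_def measure_def by (simp add: Bochner_Integration.integral_nonneg)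
    have "emeasure N {..x} = ennreal (\<integral>y. indicator {..x} y * max 0 (- f y) \<partial>lborel)"
      unfolding N_def using i
      by (subst nn_integral_eq_integral[symmetric])
         (auto simp: emeasure_density intro!: nn_integral_cong split: split_indicator)
    then have N: "cdf N x = (\<integral>y. indicator {..x} y * max 0 (- f y) \<partial>lborel)"
      unfolding cdf_def measure_def by (simp add: Bochner_Integration.integral_nonneg)
    have "cdf P x - cdf N x
        = (\<integral>y. indicator {..x} y * max 0 (f y) - indicator {..x} y * max 0 (- f y) \<partial>lborel)"
      unfolding P N using i by simp
    also have "\<dots> = primitive f x"
      unfolding primitive_def by (intro Bochner_Integration.integral_cong) (auto split: split_indicator)
    finally show "cdf P x = cdf N x" using zero by simp
  qed
  ultimately have "P = N" by (rule cdf_unique')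
  then have "AE x in lborel. ennreal (f x) = ennreal (- f x)"
    unfolding P_def N_def using fin by (subst (asm) finite_density_unique) auto
  then show ?thesis
  proof eventually_elim
    case (elim x)
    then show ?case
      by (cases "0 \<le> f x") (auto simp: ennreal_neg ennreal_eq_0_iff)
  qed
qed

text \<open>Fubini for \<open>h x * p y\<close>: the two terms on the left are its integrals over
  the half planes \<open>y \<le> x\<close> and \<open>y > x\<close>, the diagonal being null. The
  right side is the boundary term at infinity.\<close>

lemma primitive_by_parts:
  assumes h: "integrable lborel h" and p: "integrable lborel p"
  shows "(\<integral>x. h x * primitive p x \<partial>lborel) + (\<integral>x. primitive h x * p x \<partial>lborel)
    = (\<integral>x. h x \<partial>lborel) * (\<integral>x. p x \<partial>lborel)"
proof -
  note [measurable] = borel_measurable_integrable[OF h] borel_measurable_integrable[OF p]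
  have prod: "integrable (lborel \<Otimes>\<^sub>M lborel) (\<lambda>(x, y). h x * p y)"
    by (rule lborel_pair.Fubini_integrable) (use h p in \<open>auto simp: abs_mult\<close>)
  have i1: "integrable (lborel \<Otimes>\<^sub>M lborel) (\<lambda>(x, y). h x * (indicator {..x} y * p y))"
    unfolding indicator_def greaterThan_iff atMost_iff
    by (rule Bochner_Integration.integrable_bound[OF prod]) (measurable, auto simp: abs_mult)
  have i2: "integrable (lborel \<Otimes>\<^sub>M lborel) (\<lambda>(x, y). h x * (indicator {x<..} y * p y))"
    unfolding indicator_def greaterThan_iff atMost_iff
    by (rule Bochner_Integration.integrable_bound[OF prod]) (measurable, auto simp: abs_mult)
  have 1: "(\<integral>x. h x * primitive p x \<partial>lborel)
      = (\<integral>z. (\<lambda>(x, y). h x * (indicator {..x} y * p y)) z \<partial>(lborel \<Otimes>\<^sub>M lborel))"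
    using lborel_pair.integral_fst'[OF i1] by (simp add: primitive_def)
  have "(\<integral>x. primitive h x * p x \<partial>lborel) = (\<integral>y. (\<integral>x. indicator {..y} x * h x * p y \<partial>lborel) \<partial>lborel)"
    unfolding primitive_def by simp
  also have "\<dots> = (\<integral>y. (\<integral>x. h x * (indicator {x<..} y * p y) \<partial>lborel) \<partial>lborel)"
  proof (rule Bochner_Integration.integral_cong[OF refl], rule integral_cong_AE)
    fix y
    show "AE x in lborel. indicator {..y} x * h x * p y = h x * (indicator {x<..} y * p y)"
      using AE_lborel_singleton[of y] by eventually_elim (auto split: split_indicator)
    have [measurable]: "{x. x < y} \<in> sets borel" by simp
    show "(\<lambda>x. h x * (indicator {x<..} y * p y)) \<in> borel_measurable lborel"
      by (auto simp: indicator_def)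
  qed auto
  also have "\<dots> = (\<integral>z. (\<lambda>(x, y). h x * (indicator {x<..} y * p y)) z \<partial>(lborel \<Otimes>\<^sub>M lborel))"
    using lborel_pair.integral_snd[OF i2] by simp
  finally have "(\<integral>x. h x * primitive p x \<partial>lborel) + (\<integral>x. primitive h x * p x \<partial>lborel)
      = (\<integral>z. (\<lambda>(x, y). h x * (indicator {..x} y * p y)) z + (\<lambda>(x, y). h x * (indicator {x<..} y * p y)) z
          \<partial>(lborel \<Otimes>\<^sub>M lborel))"
    unfolding 1 using i1 i2 by (simp add: Bochner_Integration.integral_add)
  also have "\<dots> = (\<integral>z. (\<lambda>(x, y). h x * p y) z \<partial>(lborel \<Otimes>\<^sub>M lborel))"
    by (intro Bochner_Integration.integral_cong) (auto split: split_indicator)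
  also have "\<dots> = (\<integral>x. h x \<partial>lborel) * (\<integral>x. p x \<partial>lborel)"
    using lborel_pair.integral_fst'[OF prod] by simp
  finally show ?thesis .
qed

lemma primitive_has_real_derivative:
  assumes p: "integrable lborel p" and cont: "continuous_on UNIV p"
  shows "(primitive p has_real_derivative p x) (at x)"
proof -
  \<comment> \<open>Starting the gauge integral at \<open>x - 1\<close> makes \<open>x\<close> an
    interior point of the interval, so that the fundamental theorem gives a two-sided
    derivative.\<close>
  have eq: "primitive p t = primitive p (x - 1) + integral {x-1..t} p" if "x - 1 \<le> t" for t
  proof -
    have "set_integrable lborel {x-1..t} p"
      by (rule borel_integrable_atLeastAtMost') (rule continuous_on_subset[OF cont], simp)
    then have "integral {x-1..t} p = (\<integral>y. indicator {x-1..t} y * p y \<partial>lborel)"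
      by (simp add: set_borel_integral_eq_integral(2)[symmetric] set_lebesgue_integral_def)
    also have "\<dots> = (\<integral>y. indicator {x-1<..t} y * p y \<partial>lborel)"
    proof (rule integral_cong_AE)
      show "AE y in lborel. indicator {x-1..t} y * p y = indicator {x-1<..t} y * p y"
        using AE_lborel_singleton[of "x-1"] by eventually_elim (auto split: split_indicator)
    qed (use borel_measurable_integrable[OF p] in auto)
    finally show ?thesis using primitive_diff[OF p that] by simp
  qed
  have "((\<lambda>t. integral {x-1..t} p) has_real_derivative p x) (at x within {x-1..x+1})"
    by (rule integral_has_real_derivative) (auto intro: continuous_on_subset[OF cont])
  then have "((\<lambda>t. primitive p (x-1) + integral {x-1..t} p) has_real_derivative p x) (at x within {x-1..x+1})"
    by (auto intro!: derivative_eq_intros)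
  then have "(primitive p has_real_derivative p x) (at x within {x-1..x+1})"
  proof (rule has_field_derivative_transform_within[of _ _ _ _ 1])
    fix t assume "t \<in> {x-1..x+1}"
    then have "x - 1 \<le> t" by simp
    from eq[OF this] show "primitive p (x-1) + integral {x-1..t} p = primitive p t" ..
  qed simp_all
  moreover have "at x within {x-1..x+1} = at x"
    by (rule at_within_interior) simp
  ultimately show ?thesis by simp
qed

section \<open>Borel representatives and passage from Lebesgue to Borel integrals\<close>

text \<open>Primitives are integrals over \<open>lborel\<close>, while members of \<open>L2\<close>
  are only Lebesgue measurable on the interval. The completion supplies a Borel function that agrees
  almost everywhere and can be set to 0 outside; integrability follows from
  \<open>|t| \<le> 1 + t^2\<close>, as the interval has finite measure.\<close>

lemma L2_borel_representative:
  assumes u: "u \<in> L2 {a<..<b}"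
  obtains u' where "integrable lborel u'" "\<And>x. x \<notin> {a<..<b} \<Longrightarrow> u' x = 0"
    "AE x in lborel. x \<in> {a<..<b} \<longrightarrow> u x = u' x"
proof -
  let ?S = "{a<..<b}"
  have fm: "finite_measure (lebesgue_on ?S)"
    by (intro finite_measure_lebesgue_on) auto
  from u have [measurable]: "u \<in> borel_measurable (lebesgue_on ?S)"
    and sq: "integrable (lebesgue_on ?S) (\<lambda>x. (u x)\<^sup>2)"
    by (auto simp: L2_def)
  have "integrable (lebesgue_on ?S) u"
  proof (rule Bochner_Integration.integrable_bound[of _ "\<lambda>x. 1 + (u x)\<^sup>2"])
    show "integrable (lebesgue_on ?S) (\<lambda>x. 1 + (u x)\<^sup>2)"
      using sq finite_measure.integrable_const[OF fm, of "1::real"] by (intro Bochner_Integration.integrable_add)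
    have "\<bar>t\<bar> \<le> 1 + t\<^sup>2" for t :: real
      using zero_le_power2[of "\<bar>t\<bar> - 1"] unfolding power2_diff by simp
    then show "AE x in lebesgue_on ?S. norm (u x) \<le> norm (1 + (u x)\<^sup>2)" by simp
  qed measurable
  then have int: "integrable lebesgue (\<lambda>x. indicator ?S x * u x)"
    by (subst (asm) integrable_restrict_space) auto
  then have "(\<lambda>x. indicator ?S x * u x) \<in> borel_measurable lebesgue" by auto
  from completion_ex_borel_measurable_real[OF this] obtain f where
    [measurable]: "f \<in> borel_measurable lborel" and f: "AE x in lborel. indicator ?S x * u x = f x"
    by auto
  have ae: "AE x in lborel. indicator ?S x * u x = indicator ?S x * f x"
    using f by eventually_elim (auto split: split_indicator)
  have "integrable lebesgue (\<lambda>x. indicator ?S x * f x)"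
  proof (rule integrable_cong_AE_imp[OF int])
    show "(\<lambda>x. indicator ?S x * f x) \<in> borel_measurable lebesgue"
      by (intro measurable_completion) measurable
    show "AE x in lebesgue. indicator ?S x * u x = indicator ?S x * f x"
      using ae by (simp only: AE_completion_iff)
  qed
  then have "integrable lborel (\<lambda>x. indicator ?S x * f x)"
    by (subst (asm) integrable_completion) auto
  moreover have "AE x in lborel. x \<in> ?S \<longrightarrow> u x = indicator ?S x * f x"
    using ae by eventually_elim auto
  ultimately show ?thesis by (intro that[of "\<lambda>x. indicator ?S x * f x"]) auto
qed

lemma integral_lebesgue_on_eq_lborel:
  fixes u u' :: "real \<Rightarrow> real"
  assumes [measurable]: "u' \<in> borel_measurable borel" "S \<in> sets borel"
    and "\<And>x. x \<notin> S \<Longrightarrow> u' x = 0" and ae: "AE x in lborel. x \<in> S \<longrightarrow> u x = u' x"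
  shows "(\<integral>x. u x \<partial>lebesgue_on S) = (\<integral>x. u' x \<partial>lborel)"
proof -
  have S: "S \<in> sets lebesgue" using assms(2) by simp
  have "(\<integral>x. u x \<partial>lebesgue_on S) = (\<integral>x. indicator S x *\<^sub>R u x \<partial>lebesgue)"
    by (rule integral_restrict_space) (use S in auto)
  also have "\<dots> = (\<integral>x. u' x \<partial>lebesgue)"
  proof (rule integral_cong_AE)
    show ae': "AE x in lebesgue. indicator S x *\<^sub>R u x = u' x"
      unfolding AE_completion_iff using ae
      by eventually_elim (auto simp: assms(3) split: split_indicator)
    show m: "u' \<in> borel_measurable lebesgue" by (intro measurable_completion) auto
    \<comment> \<open>Measurability of \<open>u\<close> is not assumed: it comes from that of
      \<open>u'\<close>, because Lebesgue measure is complete.\<close>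
    show "(\<lambda>x. indicator S x *\<^sub>R u x) \<in> borel_measurable lebesgue"
      using m by (rule borel_measurable_AE) (use ae' in \<open>simp add: eq_commute\<close>)
  qed
  also have "\<dots> = (\<integral>x. u' x \<partial>lborel)" by (rule integral_completion) simp
  finally show ?thesis .
qed

section \<open>Weak derivatives in one dimension\<close>

text \<open>Continuous approximations from below of the indicator of \<open>{a<..<t}\<close>, supported in
  \<open>{a + 1/n..t - 1/n}\<close>.\<close>

definition trapezoid :: "nat \<Rightarrow> real \<Rightarrow> real \<Rightarrow> real \<Rightarrow> real" where
  "trapezoid n a t y = max 0 (min 1 (real n * min (y - a) (t - y) - 1))"

lemma continuous_on_trapezoid: "continuous_on A (trapezoid n a t)"
  unfolding trapezoid_def[abs_def] by (intro continuous_intros)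

lemma trapezoid_measurable [measurable]: "trapezoid n a t \<in> borel_measurable borel"
  by (intro borel_measurable_continuous_onI continuous_on_trapezoid)

lemma trapezoid_bounds: "0 \<le> trapezoid n a t y" "trapezoid n a t y \<le> 1"
  by (auto simp: trapezoid_def)

lemma trapezoid_nonzero:
  assumes "trapezoid n a t y \<noteq> 0"
  shows "0 < n" "a + 1 / real n \<le> y" "y \<le> t - 1 / real n"
proof -
  have 1: "1 < real n * min (y - a) (t - y)"
    using assms by (auto simp: trapezoid_def max_def min_def split: if_splits)
  then show "0 < n" by (cases n) auto
  then have n: "0 < real n" by simp
  have "1 / real n \<le> min (y - a) (t - y)"
    unfolding pos_divide_le_eq[OF n] by (subst mult.commute) (use 1 in linarith)
  then show "a + 1 / real n \<le> y" "y \<le> t - 1 / real n" by auto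
qed

lemma trapezoid_tendsto: "(\<lambda>n. trapezoid n a t y) \<longlonglongrightarrow> indicator {a<..<t} y"
proof (cases "a < y \<and> y < t")
  case True
  then have "0 < min (y - a) (t - y)" by simp
  then obtain N where N: "2 < real N * min (y - a) (t - y)"
    using reals_Archimedean3 by blast
  have "\<forall>\<^sub>F n in sequentially. trapezoid n a t y = indicator {a<..<t} y"
    using eventually_ge_at_top[of N]
  proof eventually_elim
    case (elim n)
    then have "real N * min (y - a) (t - y) \<le> real n * min (y - a) (t - y)"
      using True by (intro mult_right_mono) auto
    with N have "2 < real n * min (y - a) (t - y)" by linarith
    then show ?case using True by (simp add: trapezoid_def)
  qed
  then show ?thesis by (rule tendsto_eventually)
next
  case False
  have "trapezoid n a t y = 0" for n
  proof (rule ccontr)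
    assume nz: "trapezoid n a t y \<noteq> 0"
    from trapezoid_nonzero[OF this] have "0 < 1 / real n" by simp
    with trapezoid_nonzero[OF nz] False show False by linarith
  qed
  with False show ?thesis by simp
qed

lemma integral_trapezoid_tendsto:
  assumes f: "integrable lborel f"
  shows "(\<lambda>n. \<integral>y. f y * trapezoid n a t y \<partial>lborel) \<longlonglongrightarrow> (\<integral>y. f y * indicator {a<..<t} y \<partial>lborel)"
proof (rule integral_dominated_convergence)
  note [measurable] = borel_measurable_integrable[OF f]
  show "integrable lborel (\<lambda>y. \<bar>f y\<bar>)" using f by simp
  show "AE y in lborel. (\<lambda>n. f y * trapezoid n a t y) \<longlonglongrightarrow> f y * indicator {a<..<t} y"
    by (intro AE_I2 tendsto_intros trapezoid_tendsto)
  show "AE y in lborel. norm (f y * trapezoid n a t y) \<le> \<bar>f y\<bar>" for n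
    by (intro AE_I2) (simp add: abs_mult trapezoid_bounds mult_left_le)
qed (use borel_measurable_integrable[OF f] in measurable)

lemma integrable_times_trapezoid:
  assumes f: "integrable lborel f"
  shows "integrable lborel (\<lambda>y. f y * trapezoid n a t y)"
  by (rule Bochner_Integration.integrable_bound[OF f])
     (use borel_measurable_integrable[OF f] in \<open>auto simp: abs_mult trapezoid_bounds mult_left_le\<close>)

lemma integrable_trapezoid: "integrable lborel (trapezoid n a t)"
proof -
  have "integrable lborel (\<lambda>y. indicator {a..t} y * trapezoid n a t y)"
    by (intro integrable_times_trapezoid integrable_real_indicator) (auto simp: emeasure_lborel_Icc_eq)
  moreover have "indicator {a..t} y * trapezoid n a t y = trapezoid n a t y" for y
  proof (cases "trapezoid n a t y = 0")
    case False
    have "0 \<le> 1 / real n" by simp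
    with trapezoid_nonzero(2,3)[OF False] have "y \<in> {a..t}"
      unfolding atLeastAtMost_iff by linarith
    then show ?thesis by simp
  qed simp
  ultimately show ?thesis by simp
qed

text \<open>The test functions \<open>p\<close> of mean zero are the derivatives of compactly
  supported C^1 functions. One fixed trapezoid of positive mass determines the candidate
  \<open>c\<close>. Every other trapezoid differs from a multiple of it by a function of mean zero,
  so \<open>f - c\<close> is orthogonal to all trapezoids; in the limit its primitive
  vanishes.\<close>

lemma du_Bois_Reymond:
  fixes f :: "real \<Rightarrow> real"
  assumes "a < b" and f: "integrable lborel f"
    and orth: "\<And>\<alpha> \<beta> p. a < \<alpha> \<Longrightarrow> \<beta> < b \<Longrightarrow> continuous_on UNIV p \<Longrightarrow> integrable lborel p \<Longrightarrow>
        (\<And>x. p x \<noteq> 0 \<Longrightarrow> \<alpha> \<le> x \<and> x \<le> \<beta>) \<Longrightarrow> (\<integral>x. p x \<partial>lborel) = 0 \<Longrightarrow> (\<integral>x. f x * p x \<partial>lborel) = 0"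
  shows "\<exists>c. AE x in lborel. x \<in> {a<..<b} \<longrightarrow> f x = c"
proof -
  have ind: "integrable lborel (indicator {a<..<b} :: real \<Rightarrow> real)"
    using \<open>a < b\<close> by simp
  have supp: "trapezoid n a t y \<noteq> 0 \<Longrightarrow> t \<le> b \<Longrightarrow> y \<in> {a<..<b}" for n t y
  proof -
    assume nz: "trapezoid n a t y \<noteq> 0" and "t \<le> b"
    from trapezoid_nonzero(1)[OF nz] have "0 < 1 / real n" by simp
    with trapezoid_nonzero[OF nz] \<open>t \<le> b\<close> show "y \<in> {a<..<b}"
      unfolding greaterThanLessThan_iff by linarith
  qed
  have ind_trap: "indicator {a<..<b} y * trapezoid n a t y = trapezoid n a t y" if "t \<le> b" for n t y
    using supp[OF _ that, of n y] by (cases "trapezoid n a t y = 0") auto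
  have "(\<lambda>n. \<integral>y. indicator {a<..<b} y * trapezoid n a b y \<partial>lborel)
      \<longlonglongrightarrow> (\<integral>y. indicator {a<..<b} y * indicator {a<..<b} y \<partial>lborel)"
    by (rule integral_trapezoid_tendsto[OF ind])
  also have "(\<integral>y. indicator {a<..<b} y * indicator {a<..<b} y \<partial>lborel)
      = (\<integral>y. indicator {a<..<b} y \<partial>lborel :: real)"
    by (intro Bochner_Integration.integral_cong) (auto split: split_indicator)
  also have "\<dots> = b - a" using \<open>a < b\<close> by simp
  finally have "(\<lambda>n. \<integral>y. trapezoid n a b y \<partial>lborel) \<longlonglongrightarrow> b - a"
    by (simp add: ind_trap)
  then have "\<forall>\<^sub>F n in sequentially. 0 < (\<integral>y. trapezoid n a b y \<partial>lborel) \<and> 0 < n"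
    by (intro eventually_conj order_tendstoD(1)[of _ "b - a"] eventually_gt_at_top)
       (use \<open>a < b\<close> in auto)
  then obtain m where m: "0 < (\<integral>y. trapezoid m a b y \<partial>lborel)" "0 < m"
    by (auto simp: eventually_sequentially)
  define I where "I = (\<integral>y. trapezoid m a b y \<partial>lborel)"
  define c where "c = (\<integral>y. f y * trapezoid m a b y \<partial>lborel) / I"
  have I: "I > 0" using m by (simp add: I_def)
  have key: "(\<integral>y. f y * trapezoid n a t y \<partial>lborel) = c * (\<integral>y. trapezoid n a t y \<partial>lborel)"
    if n: "0 < n" "t \<le> b" for n t
  proof -
    define J where "J = (\<integral>y. trapezoid n a t y \<partial>lborel)"
    \<comment> \<open>The factor \<open>J / I\<close> is the one that gives \<open>p\<close> mean
      zero.\<close>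
    define p where "p y = trapezoid n a t y - J / I * trapezoid m a b y" for y
    have "(\<integral>x. f x * p x \<partial>lborel) = 0"
    proof (rule orth[of "min (a + 1/n) (a + 1/m)" "max (t - 1/n) (b - 1/m)"])
      show "a < min (a + 1/n) (a + 1/m)" using n m by simp
      have "t - 1/n < b" "b - 1/m < b" using n m by (auto intro: order_less_le_trans[of _ t])
      then show "max (t - 1/n) (b - 1/m) < b" by simp
      show "continuous_on UNIV p"
        unfolding p_def[abs_def] by (intro continuous_intros continuous_on_trapezoid)
      show "integrable lborel p"
        unfolding p_def[abs_def]
        by (intro Bochner_Integration.integrable_diff integrable_mult_right integrable_trapezoid)
      show "(\<integral>x. p x \<partial>lborel) = 0"
        unfolding p_def using I
        by (subst Bochner_Integration.integral_diff)
           (auto simp: integrable_trapezoid I_def[symmetric] J_def[symmetric])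
      fix x assume "p x \<noteq> 0"
      then have "trapezoid n a t x \<noteq> 0 \<or> trapezoid m a b x \<noteq> 0" by (auto simp: p_def)
      then show "min (a + 1/n) (a + 1/m) \<le> x \<and> x \<le> max (t - 1/n) (b - 1/m)"
        using trapezoid_nonzero(2,3)[of n a t x] trapezoid_nonzero(2,3)[of m a b x]
        unfolding min_le_iff_disj le_max_iff_disj by blast
    qed
    also have "(\<integral>x. f x * p x \<partial>lborel)
        = (\<integral>x. f x * trapezoid n a t x - J / I * (f x * trapezoid m a b x) \<partial>lborel)"
      by (intro Bochner_Integration.integral_cong) (auto simp: p_def algebra_simps)
    also have "\<dots> = (\<integral>x. f x * trapezoid n a t x \<partial>lborel)
        - (\<integral>x. J / I * (f x * trapezoid m a b x) \<partial>lborel)"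
      by (intro Bochner_Integration.integral_diff integrable_mult_right integrable_times_trapezoid f)
    also have "\<dots> = (\<integral>x. f x * trapezoid n a t x \<partial>lborel) - c * J"
      unfolding integral_mult_right_zero c_def by simp
    finally show ?thesis by (simp add: J_def)
  qed
  define F where "F y = indicator {a<..<b} y * (f y - c)" for y
  have F_eq: "F = (\<lambda>y. indicator {a<..<b} y * f y - c * indicator {a<..<b} y)"
    by (auto simp: F_def fun_eq_iff algebra_simps)
  have F: "integrable lborel F"
    unfolding F_eq
    by (intro Bochner_Integration.integrable_diff integrable_mult_right ind integrable_indicator_times f) auto
  have "primitive F x = 0" for x
  proof -
    \<comment> \<open>Trapezoids must stay inside the interval. As \<open>F\<close> vanishes to the
      right of \<open>b\<close>, replacing \<open>x\<close> by \<open>t\<close> does not change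
      \<open>primitive F x\<close>.\<close>
    define t where "t = min x b"
    have "t \<le> b" by (simp add: t_def)
    have "(\<integral>y. F y * trapezoid n a t y \<partial>lborel) = 0" if "0 < n" for n
    proof -
      have "(\<integral>y. F y * trapezoid n a t y \<partial>lborel)
          = (\<integral>y. f y * trapezoid n a t y - c * trapezoid n a t y \<partial>lborel)"
      proof (intro Bochner_Integration.integral_cong refl)
        fix y
        have "F y * trapezoid n a t y = (f y - c) * (indicator {a<..<b} y * trapezoid n a t y)"
          by (simp add: F_def)
        also have "\<dots> = f y * trapezoid n a t y - c * trapezoid n a t y"
          unfolding ind_trap[OF \<open>t \<le> b\<close>] by (simp add: algebra_simps)
        finally show "F y * trapezoid n a t y = f y * trapezoid n a t y - c * trapezoid n a t y" .
      qed
      also have "\<dots> = 0"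
        using key[OF that \<open>t \<le> b\<close>]
        by (subst Bochner_Integration.integral_diff)
           (auto intro!: integrable_times_trapezoid f integrable_trapezoid)
      finally show ?thesis .
    qed
    then have "(\<lambda>n. \<integral>y. F y * trapezoid n a t y \<partial>lborel) \<longlonglongrightarrow> 0"
      by (intro tendsto_eventually eventually_mono[OF eventually_gt_at_top[of 0]]) auto
    with integral_trapezoid_tendsto[OF F] have "(\<integral>y. F y * indicator {a<..<t} y \<partial>lborel) = 0"
      by (rule LIMSEQ_unique)
    also have "(\<integral>y. F y * indicator {a<..<t} y \<partial>lborel) = primitive F x"
      unfolding primitive_def
    proof (rule integral_cong_AE)
      show "AE y in lborel. F y * indicator {a<..<t} y = indicator {..x} y * F y"
        using AE_lborel_singleton[of x]
        by eventually_elim (auto simp: F_def t_def split: split_indicator)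
    qed (use borel_measurable_integrable[OF F] in measurable)
    finally show ?thesis .
  qed
  from AE_zero_if_primitive_zero[OF F this] have "AE x in lborel. x \<in> {a<..<b} \<longrightarrow> f x = c"
    by eventually_elim (auto simp: F_def)
  then show ?thesis ..
qed

text \<open>The difference of \<open>u\<close> and the primitive of its weak derivative satisfies
  the hypothesis of \<open>du_Bois_Reymond\<close>. A mean-zero \<open>p\<close> is the derivative
  of \<open>primitive p\<close>, which is an admissible test function: it vanishes beyond \<beta>
  exactly because the mean is zero. The same fact removes the boundary term in
  \<open>primitive_by_parts\<close>.\<close>

lemma weak_deriv_primitive:
  assumes "a < b" and u: "u \<in> L2 {a<..<b}" and g: "g \<in> L2 {a<..<b}"
    and weak: "has_weak_deriv {a<..<b} u g"
  obtains c h where "integrable lborel h" "\<And>x. x \<notin> {a<..<b} \<Longrightarrow> h x = 0"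
    "AE x in lborel. x \<in> {a<..<b} \<longrightarrow> g x = h x"
    "AE x in lborel. x \<in> {a<..<b} \<longrightarrow> u x = c + primitive h x"
proof -
  from L2_borel_representative[OF u] obtain u' where u': "integrable lborel u'"
    "\<And>x. x \<notin> {a<..<b} \<Longrightarrow> u' x = 0" "AE x in lborel. x \<in> {a<..<b} \<longrightarrow> u x = u' x" by blast
  from L2_borel_representative[OF g] obtain h where h: "integrable lborel h"
    "\<And>x. x \<notin> {a<..<b} \<Longrightarrow> h x = 0" "AE x in lborel. x \<in> {a<..<b} \<longrightarrow> g x = h x" by blast
  note [measurable] = borel_measurable_integrable[OF u'(1)] borel_measurable_integrable[OF h(1)]
  have contP: "continuous_on UNIV (primitive q)" if "integrable lborel q" for q
    by (intro continuous_at_imp_continuous_on ballI isCont_primitive that)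
  have [measurable]: "primitive q \<in> borel_measurable borel" if "integrable lborel q" for q
    by (intro borel_measurable_continuous_onI contP that)
  \<comment> \<open>To the right of \<open>b\<close> the function \<open>primitive h\<close> is a
    constant that need not be 0; the indicator makes \<open>f\<close> integrable on the
    line.\<close>
  define f where "f x = u' x - indicator {a<..<b} x * primitive h x" for x
  have prim_bd: "\<bar>primitive h x\<bar> \<le> (\<integral>y. \<bar>h y\<bar> \<partial>lborel)" for x
  proof -
    have "\<bar>primitive h x\<bar> \<le> primitive (\<lambda>y. \<bar>h y\<bar>) x"
      unfolding primitive_def
      by (rule Bochner_Integration.integral_abs_bound_integral)
         (auto intro!: integrable_indicator_times h(1) simp: abs_mult)
    also have "\<dots> \<le> (\<integral>y. \<bar>h y\<bar> \<partial>lborel)"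
      by (rule primitive_bounds) (use h(1) in auto)
    finally show ?thesis .
  qed
  have ip: "integrable lborel (\<lambda>x. indicator {a<..<b} x * primitive h x)"
  proof (rule Bochner_Integration.integrable_bound)
    show "integrable lborel (\<lambda>x. indicator {a<..<b} x * (\<integral>y. \<bar>h y\<bar> \<partial>lborel))"
      using \<open>a < b\<close> by (intro integrable_mult_left integrable_real_indicator) auto
    show "AE x in lborel. norm (indicator {a<..<b} x * primitive h x)
        \<le> norm (indicator {a<..<b} x * (\<integral>y. \<bar>h y\<bar> \<partial>lborel))"
      using prim_bd by (intro AE_I2) (auto split: split_indicator)
  qed (use h(1) in measurable)
  have f: "integrable lborel f"
    unfolding f_def[abs_def] by (intro Bochner_Integration.integrable_diff u' ip)
  have orth: "(\<integral>x. f x * p x \<partial>lborel) = 0"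
    if ab: "a < \<alpha>" "\<beta> < b" and p: "continuous_on UNIV p" "integrable lborel p"
      and supp: "\<And>x. p x \<noteq> 0 \<Longrightarrow> \<alpha> \<le> x \<and> x \<le> \<beta>" and zero: "(\<integral>x. p x \<partial>lborel) = 0" for \<alpha> \<beta> p
  proof -
    note [measurable] = borel_measurable_integrable[OF p(2)]
    have "bounded (p ` {\<alpha>..\<beta>})"
      by (intro compact_imp_bounded compact_continuous_image continuous_on_subset[OF p(1)]) auto
    then obtain B where B: "\<forall>x\<in>{\<alpha>..\<beta>}. \<bar>p x\<bar> \<le> B" "B > 0"
      unfolding bounded_pos by auto
    have pB: "\<bar>p x\<bar> \<le> B" for x
      using B supp[of x] by (cases "p x = 0") auto
    have int_p: "integrable lborel (\<lambda>x. q x * p x)" if q: "integrable lborel q" for q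
    proof (rule Bochner_Integration.integrable_bound)
      show "integrable lborel (\<lambda>x. B * q x)" using q by simp
      show "AE x in lborel. norm (q x * p x) \<le> norm (B * q x)"
        using pB B(2) by (intro AE_I2) (auto simp: abs_mult mult.commute intro!: mult_right_mono)
    qed (use borel_measurable_integrable[OF q] in measurable)
    define \<psi> where "\<psi> = primitive p"
    have der: "(\<psi> has_real_derivative p x) (at x)" for x
      unfolding \<psi>_def by (rule primitive_has_real_derivative[OF p(2,1)])
    have \<psi>0: "\<psi> x = 0" if "x < \<alpha> \<or> \<beta> < x" for x
      using that
    proof
      assume "x < \<alpha>"
      then have "indicator {..x} y * p y = 0" for y
        using supp[of y] by (cases "p y = 0") (auto split: split_indicator)
      then show ?thesis unfolding \<psi>_def primitive_def by (simp only: Bochner_Integration.integral_zero)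
    next
      assume "\<beta> < x"
      then have "indicator {..x} y * p y = p y" for y
        using supp[of y] by (cases "p y = 0") (auto split: split_indicator)
      then show ?thesis unfolding \<psi>_def primitive_def by (simp only: zero)
    qed
    have cl: "closure {x. \<psi> x \<noteq> 0} \<subseteq> {\<alpha>..\<beta>}"
      by (rule closure_minimal) (use \<psi>0 in \<open>auto simp: not_less[symmetric]\<close>)
    have "\<psi> \<in> C1c {a<..<b}"
      unfolding C1c_def
    proof (intro CollectI conjI)
      show "\<psi> C1_differentiable_on UNIV"
        unfolding C1_differentiable_on_def
        using der p(1) by (auto simp: has_real_derivative_iff_has_vector_derivative)
      show "compact (closure {x. \<psi> x \<noteq> 0})"
        unfolding compact_eq_bounded_closed
        using bounded_subset[OF bounded_closed_interval cl] by simp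
      show "closure {x. \<psi> x \<noteq> 0} \<subseteq> {a<..<b}" using cl ab by auto
    qed
    then have "(\<integral>x. u x * deriv \<psi> x \<partial>lebesgue_on {a<..<b}) = - (\<integral>x. g x * \<psi> x \<partial>lebesgue_on {a<..<b})"
      using weak by (auto simp: has_weak_deriv_def)
    moreover have "deriv \<psi> = p" using der by (auto simp: DERIV_imp_deriv)
    moreover have "(\<integral>x. u x * p x \<partial>lebesgue_on {a<..<b}) = (\<integral>x. u' x * p x \<partial>lborel)"
      by (rule integral_lebesgue_on_eq_lborel) (use u' in auto)
    moreover have "(\<integral>x. g x * \<psi> x \<partial>lebesgue_on {a<..<b}) = (\<integral>x. h x * \<psi> x \<partial>lborel)"
      by (rule integral_lebesgue_on_eq_lborel) (use h p(2) in \<open>auto simp: \<psi>_def\<close>)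
    moreover have "(\<integral>x. h x * \<psi> x \<partial>lborel) + (\<integral>x. primitive h x * p x \<partial>lborel) = 0"
      using primitive_by_parts[OF h(1) p(2)] zero by (simp add: \<psi>_def)
    ultimately have eq: "(\<integral>x. u' x * p x \<partial>lborel) = (\<integral>x. primitive h x * p x \<partial>lborel)" by simp
    have "f x * p x = u' x * p x - indicator {a<..<b} x * primitive h x * p x" for x
      by (simp add: f_def algebra_simps)
    then have "(\<integral>x. f x * p x \<partial>lborel)
        = (\<integral>x. u' x * p x \<partial>lborel) - (\<integral>x. indicator {a<..<b} x * primitive h x * p x \<partial>lborel)"
      by (simp only:) (intro Bochner_Integration.integral_diff int_p u'(1) ip)
    also have "(\<integral>x. indicator {a<..<b} x * primitive h x * p x \<partial>lborel) = (\<integral>x. primitive h x * p x \<partial>lborel)"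
      using supp ab
      by (intro Bochner_Integration.integral_cong refl) (fastforce split: split_indicator)
    finally show ?thesis using eq by simp
  qed
  have "\<exists>c. AE x in lborel. x \<in> {a<..<b} \<longrightarrow> f x = c"
  proof (rule du_Bois_Reymond[OF \<open>a < b\<close> f])
    fix \<alpha> \<beta> and p :: "real \<Rightarrow> real"
    assume "a < \<alpha>" "\<beta> < b" "continuous_on UNIV p" "integrable lborel p"
      "\<And>x. p x \<noteq> 0 \<Longrightarrow> \<alpha> \<le> x \<and> x \<le> \<beta>" "(\<integral>x. p x \<partial>lborel) = 0"
    then show "(\<integral>x. f x * p x \<partial>lborel) = 0" by (rule orth)
  qed
  then obtain c where "AE x in lborel. x \<in> {a<..<b} \<longrightarrow> f x = c" ..
  with u'(3) have "AE x in lborel. x \<in> {a<..<b} \<longrightarrow> u x = c + primitive h x"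
    by eventually_elim (auto simp: f_def)
  with h show ?thesis by (intro that)
qed

section \<open>Coercivity of the energy density\<close>

text \<open>Up to a small \<open>s0\<close> the difference quotient at 0 exceeds
  \<open>d / 2\<close>; beyond \<open>s0\<close>, monotonicity keeps \<phi> above the positive value
  \<open>\<phi> s0\<close>.\<close>

lemma mono_right_derivative_lower_bound:
  fixes \<phi> :: "real \<Rightarrow> real"
  assumes mono: "mono_on {0..} \<phi>" and zero: "\<phi> 0 = 0" and pos: "\<And>t. 0 < t \<Longrightarrow> 0 < \<phi> t"
    and der: "(\<phi> has_real_derivative d) (at_right 0)" and "0 < d"
  obtains c where "0 < c" "\<And>s. 0 \<le> s \<Longrightarrow> c * min s 1 \<le> \<phi> s"
proof -
  from der have "((\<lambda>y. \<phi> y / y) \<longlongrightarrow> d) (at_right 0)"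
    by (simp add: has_field_derivative_iff zero)
  then have "\<forall>\<^sub>F y in at_right 0. d / 2 < \<phi> y / y"
    using \<open>0 < d\<close> by (intro order_tendstoD(1)) auto
  then obtain b where b: "b > 0" "\<And>y. 0 < y \<Longrightarrow> y < b \<Longrightarrow> d / 2 < \<phi> y / y"
    unfolding eventually_at_right_field by blast
  define s0 where "s0 = b / 2"
  define c where "c = min (d / 2) (\<phi> s0)"
  have s0: "0 < s0" "s0 < b" using b by (auto simp: s0_def)
  have "0 < c" using pos[OF s0(1)] \<open>0 < d\<close> by (simp add: c_def)
  moreover have "c * min s 1 \<le> \<phi> s" if s: "0 \<le> s" for s
  proof (cases "s \<le> s0")
    case True
    show ?thesis
    proof (cases "s = 0")
      case False
      with s have "0 < s" by simp
      have "c * min s 1 \<le> d / 2 * s"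
        using s \<open>0 < c\<close> \<open>0 < d\<close> by (intro mult_mono) (auto simp: c_def)
      also have "\<dots> \<le> \<phi> s"
        using b(2)[OF \<open>0 < s\<close>] True s0 \<open>0 < s\<close> by (simp add: field_simps)
      finally show ?thesis .
    qed (simp add: zero)
  next
    case False
    have "c * min s 1 \<le> c * 1" using \<open>0 < c\<close> by (intro mult_left_mono) auto
    also have "\<dots> \<le> \<phi> s0" by (simp add: c_def)
    also have "\<dots> \<le> \<phi> s"
      using False s0 by (intro mono_onD[OF mono]) auto
    finally show ?thesis .
  qed
  ultimately show ?thesis by (rule that)
qed

text \<open>Empty intervals are included, with bound 1. They occur when the left end is a radius
  that may exceed 1.\<close>

lemma continuous_pos_lower_bound:
  fixes f :: "real \<Rightarrow> real"
  assumes "continuous_on {a..b} f" "\<And>x. x \<in> {a..b} \<Longrightarrow> 0 < f x"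
  obtains m where "0 < m" "\<And>x. x \<in> {a..b} \<Longrightarrow> m \<le> f x"
proof (cases "a \<le> b")
  case True
  then obtain x where "x \<in> {a..b}" "\<And>y. y \<in> {a..b} \<Longrightarrow> f x \<le> f y"
    using continuous_attains_inf[of "{a..b}" f] assms(1) by auto
  then show ?thesis using assms(2) by (intro that[of "f x"]) auto
qed (auto intro: that[of 1])

text \<open>This is \<open>4 * A * B \<le> (A + B)^2\<close>. The factor 4 matches the denominator
  \<open>4 * \<epsilon>\<close> of the potential term, so that \<epsilon> cancels in the
  applications.\<close>

lemma am_gm_abs_bound:
  fixes A B k p :: real
  assumes "0 \<le> A" "0 \<le> B" "0 \<le> k" "k * p\<^sup>2 \<le> 4 * (A * B)"
  shows "sqrt k * \<bar>p\<bar> \<le> A + B"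
proof (rule power2_le_imp_le)
  have "(sqrt k * \<bar>p\<bar>)\<^sup>2 = k * p\<^sup>2" using assms by (simp add: power_mult_distrib)
  also have "\<dots> \<le> (A + B)\<^sup>2"
    using assms(4) zero_le_power2[of "A - B"] by (simp add: power2_eq_square algebra_simps)
  finally show "(sqrt k * \<bar>p\<bar>)\<^sup>2 \<le> (A + B)\<^sup>2" .
qed (use assms in auto)

text \<open>The positive limit bounds the quotient near 0, compactness bounds it on the rest of the
  interval. In this form the comparability of \<omega> and \<open>Q\<close> enters the coercivity
  estimate.\<close>

lemma ratio_lower_bound:
  fixes \<omega> Q :: "real \<Rightarrow> real"
  assumes Q: "continuous_on {0..1} Q" "\<And>t. t \<in> {0<..1} \<Longrightarrow> 0 < Q t"
    and \<omega>: "continuous_on {0..1} \<omega>" "\<And>t. t \<in> {0<..1} \<Longrightarrow> 0 < \<omega> t"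
    and lim: "((\<lambda>t. sqrt (\<omega> t / Q t)) \<longlongrightarrow> \<sigma>) (at_right 0)" and "0 < \<sigma>"
  obtains m where "0 < m" "\<And>s. s \<in> {0<..1} \<Longrightarrow> m \<le> \<omega> s / Q s"
proof -
  have "\<forall>\<^sub>F s in at_right 0. \<sigma> / 2 < sqrt (\<omega> s / Q s)"
    using lim \<open>0 < \<sigma>\<close> by (intro order_tendstoD(1)) auto
  then obtain r where r: "r > 0" "\<And>s. 0 < s \<Longrightarrow> s < r \<Longrightarrow> \<sigma> / 2 < sqrt (\<omega> s / Q s)"
    unfolding eventually_at_right_field by blast
  obtain m where m: "0 < m" "\<And>s. s \<in> {r..1} \<Longrightarrow> m \<le> \<omega> s / Q s"
  proof (rule continuous_pos_lower_bound)
    have sub: "{r..1} \<subseteq> {0..1}" using r by auto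
    show "continuous_on {r..1} (\<lambda>s. \<omega> s / Q s)"
      using Q(2) r by (intro continuous_on_divide continuous_on_subset[OF \<omega>(1) sub]
          continuous_on_subset[OF Q(1) sub]) (auto simp: less_le)
    show "0 < \<omega> s / Q s" if "s \<in> {r..1}" for s
      using that r Q(2) \<omega>(2) by auto
  qed blast
  show ?thesis
  proof (rule that[of "min m ((\<sigma> / 2)\<^sup>2)"])
    show "0 < min m ((\<sigma> / 2)\<^sup>2)" using m \<open>0 < \<sigma>\<close> by simp
    fix s :: real assume s: "s \<in> {0<..1}"
    show "min m ((\<sigma> / 2)\<^sup>2) \<le> \<omega> s / Q s"
    proof (cases "s < r")
      case True
      with s r(2)[of s] have "\<sigma> / 2 < sqrt (\<omega> s / Q s)" by simp
      then have "(\<sigma> / 2)\<^sup>2 \<le> (sqrt (\<omega> s / Q s))\<^sup>2"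
        using \<open>0 < \<sigma>\<close> by (intro power_mono) auto
      also have "\<dots> = \<omega> s / Q s" using Q(2)[OF s] \<omega>(2)[OF s] by simp
      finally show ?thesis by simp
    next
      case False
      with s m(2)[of s] show ?thesis by auto
    qed
  qed
qed

lemma phi_f_nonneg:
  assumes "\<And>t. 0 \<le> t \<Longrightarrow> 0 \<le> \<phi> t" "(\<phi> \<longlongrightarrow> L) at_top" "0 < L" "0 < \<epsilon>"
  shows "0 \<le> phi_f \<phi> ell Q \<epsilon> t"
  using assms tendsto_Lim[OF _ assms(2)] by (auto simp: phi_f_def)

text \<open>Inequalities between numbers, with \<open>p\<close> and \<open>q\<close> standing for
  the derivatives of \<open>u\<close> and \<open>v\<close>; the point is that \<open>K\<close> does
  not depend on \<epsilon>. The potential is paired with the \<open>u\<close> term in the first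
  bound and with the \<open>v\<close> term in the second. The summand 1 absorbs the saturated regime
  of \<phi>, where only \<open>|p| \<le> 1 + p^2\<close> is available.\<close>

lemma phase_field_coercive:
  fixes ell Q \<omega> \<phi> :: "real \<Rightarrow> real"
  assumes ell: "continuous_on {0..1} ell" "\<And>t. t \<in> {0<..1} \<Longrightarrow> 0 < ell t"
    and Q: "continuous_on {0..1} Q" "\<And>t. t \<in> {0<..1} \<Longrightarrow> 0 < Q t"
    and \<omega>: "continuous_on {0..1} \<omega>" "\<And>t. t \<in> {0<..1} \<Longrightarrow> 0 < \<omega> t" "\<omega> 0 = 0"
    and lim: "((\<lambda>t. sqrt (\<omega> t / Q t)) \<longlongrightarrow> \<sigma>) (at_right 0)" "0 < \<sigma>"
    and \<phi>: "mono_on {0..} \<phi>" "\<phi> 0 = 0" "\<And>t. 0 < t \<Longrightarrow> 0 < \<phi> t"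
    and L: "(\<phi> \<longlongrightarrow> L) at_top" "0 < L"
    and der: "(\<phi> has_real_derivative d) (at_right 0)" "0 < d"
  obtains K where "0 < K"
    "\<And>\<epsilon> t p q. 0 < \<epsilon> \<Longrightarrow> 1/4 \<le> t \<Longrightarrow> t \<le> 1 \<Longrightarrow>
       \<bar>p\<bar> \<le> K * (phi_f \<phi> ell Q \<epsilon> t * p\<^sup>2 + \<omega> (1 - t) / (4 * \<epsilon>) + \<epsilon> * q\<^sup>2 + 1)"
    "\<And>\<epsilon> t p q. 0 < \<epsilon> \<Longrightarrow> 0 \<le> t \<Longrightarrow> t \<le> 3/4 \<Longrightarrow>
       \<bar>q\<bar> \<le> K * (phi_f \<phi> ell Q \<epsilon> t * p\<^sup>2 + \<omega> (1 - t) / (4 * \<epsilon>) + \<epsilon> * q\<^sup>2 + 1)"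
proof -
  obtain c0 where c0: "0 < c0" "\<And>s. 0 \<le> s \<Longrightarrow> c0 * min s 1 \<le> \<phi> s"
    using mono_right_derivative_lower_bound[OF \<phi> der] by blast
  obtain m1 where m1: "0 < m1" "\<And>t. t \<in> {1/4..1} \<Longrightarrow> m1 \<le> ell t"
    by (rule continuous_pos_lower_bound[of "1/4" 1 ell])
       (auto intro!: continuous_on_subset[OF ell(1)] ell(2))
  obtain m2 where m2: "0 < m2" "\<And>t. t \<in> {0<..1} \<Longrightarrow> m2 \<le> \<omega> t / Q t"
    using ratio_lower_bound[OF Q \<omega>(1,2) lim] by blast
  \<comment> \<open>\<omega> is evaluated at \<open>1 - t\<close>, which is at least 1/4 when
    \<open>t \<le> 3/4\<close>.\<close>
  obtain m3 where m3: "0 < m3" "\<And>t. t \<in> {1/4..1} \<Longrightarrow> m3 \<le> \<omega> t"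
    by (rule continuous_pos_lower_bound[of "1/4" 1 \<omega>])
       (auto intro!: continuous_on_subset[OF \<omega>(1)] \<omega>(2))
  define c where "c = min c0 (c0 * (m1 * m2))"
  have c: "0 < c" using c0 m1 m2 by (simp add: c_def)
  have \<omega>0: "0 \<le> \<omega> t" if "0 \<le> t" "t \<le> 1" for t
    using \<omega>(2)[of t] \<omega>(3) that by (cases "t = 0") (auto simp: less_le)
  have \<phi>0: "0 \<le> \<phi> t" if "0 \<le> t" for t
    using \<phi>(2) \<phi>(3)[of t] that by (cases "t = 0") (auto simp: less_le)
  have pf0: "0 \<le> phi_f \<phi> ell Q \<epsilon> t" if "0 < \<epsilon>" for \<epsilon> t
    by (rule phi_f_nonneg[OF \<phi>0 L that])
  \<comment> \<open>Dichotomy from the bound by \<open>min (\<epsilon> * F) 1\<close>. If it is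
    saturated, or if \<open>t = 1\<close>, the coefficient itself is bounded below. Otherwise it is
    at least \<open>c0 * \<epsilon> * ell t / Q (1 - t)\<close>, and multiplication by
    \<open>\<omega> (1 - t)\<close> turns the degenerate denominator into the ratio bounded by
    \<open>m2\<close>.\<close>
  have coeff: "c \<le> phi_f \<phi> ell Q \<epsilon> t \<or> c * \<epsilon> \<le> phi_f \<phi> ell Q \<epsilon> t * \<omega> (1 - t)"
    if "0 < \<epsilon>" "1/4 \<le> t" "t \<le> 1" for \<epsilon> t
  proof (cases "t = 1")
    case True
    have "c0 \<le> L"
    proof (rule tendsto_lowerbound[OF L(1)])
      show "\<forall>\<^sub>F s in at_top. c0 \<le> \<phi> s"
        using eventually_ge_at_top[of 1]
      proof eventually_elim
        case (elim s)
        with c0(2)[of s] show ?case by simp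
      qed
    qed simp
    moreover have "Lim at_top \<phi> = L" by (rule tendsto_Lim[OF _ L(1)]) simp
    ultimately show ?thesis using True by (auto simp: phi_f_def c_def min_le_iff_disj)
  next
    case False
    define F where "F = ell t / Q (1 - t)"
    have Qt: "0 < Q (1 - t)" and Et: "m1 \<le> ell t" using Q(2)[of "1 - t"] m1(2)[of t] False that by auto
    have F: "0 \<le> F" using Qt Et m1 by (simp add: F_def)
    have pf: "phi_f \<phi> ell Q \<epsilon> t = \<phi> (\<epsilon> * F)"
      using False F by (simp add: phi_f_def f_deg_def F_def)
    have low: "c0 * min (\<epsilon> * F) 1 \<le> \<phi> (\<epsilon> * F)"
      using F that by (intro c0) auto
    show ?thesis
    proof (cases "1 \<le> \<epsilon> * F")
      case True
      with low show ?thesis by (auto simp: pf c_def min_le_iff_disj)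
    next
      case False
      have "c * \<epsilon> \<le> c0 * (m1 * m2) * \<epsilon>"
        using that by (intro mult_right_mono) (auto simp: c_def)
      also have "\<dots> \<le> c0 * (ell t * (\<omega> (1 - t) / Q (1 - t))) * \<epsilon>"
        using that c0(1) m1(1) m2(2)[of "1 - t"] m2(1) Et order_trans[OF less_imp_le[OF m1(1)] Et] \<open>t \<noteq> 1\<close>
        by (intro mult_right_mono mult_left_mono mult_mono) auto
      also have "\<dots> = c0 * (\<epsilon> * F) * \<omega> (1 - t)" by (simp add: F_def)
      also have "\<dots> \<le> \<phi> (\<epsilon> * F) * \<omega> (1 - t)"
        using low False that by (intro mult_right_mono \<omega>0) auto
      finally show ?thesis by (simp add: pf)
    qed
  qed
  define K where "K = max 1 (max (1 / c) (max (1 / sqrt c) (1 / sqrt m3)))"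
  have K: "1 \<le> K" "1 / c \<le> K" "1 / sqrt c \<le> K" "1 / sqrt m3 \<le> K" by (auto simp: K_def)
  have scale: "x \<le> K * y" if "s * x \<le> y" "0 \<le> y" "0 < s" "1 / s \<le> K" for s x y :: real
  proof -
    have "x \<le> 1 / s * y" using that by (simp add: field_simps)
    also have "\<dots> \<le> K * y" using that by (intro mult_right_mono)
    finally show ?thesis .
  qed
  show ?thesis
  proof (rule that[of K])
    show "0 < K" using K by simp
    fix \<epsilon> t p q :: real assume e: "0 < \<epsilon>"
    define A where "A = phi_f \<phi> ell Q \<epsilon> t * p\<^sup>2"
    define B where "B = \<omega> (1 - t) / (4 * \<epsilon>)"
    define D where "D = \<epsilon> * q\<^sup>2"
    have A0: "0 \<le> A" and D0: "0 \<le> D" using pf0[OF e] e by (auto simp: A_def D_def)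
    {
      assume t: "1/4 \<le> t" "t \<le> 1"
      have B0: "0 \<le> B" using \<omega>0[of "1 - t"] t e by (simp add: B_def)
      from coeff[OF e t] show "\<bar>p\<bar> \<le> K * (A + B + D + 1)"
      proof
        assume "c \<le> phi_f \<phi> ell Q \<epsilon> t"
        then have "c * p\<^sup>2 \<le> A" by (auto simp: A_def intro: mult_right_mono)
        then have "p\<^sup>2 \<le> K * A" using A0 c K by (intro scale)
        moreover have "\<bar>p\<bar> \<le> 1 + p\<^sup>2"
          using zero_le_power2[of "\<bar>p\<bar> - 1"] unfolding power2_diff by simp
        moreover have "0 \<le> K * B" "0 \<le> K * D" using B0 D0 K by auto
        ultimately have "\<bar>p\<bar> \<le> K * A + K * B + K * D + K" using K(1) by linarith
        then show ?thesis by (simp add: algebra_simps)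
      next
        assume "c * \<epsilon> \<le> phi_f \<phi> ell Q \<epsilon> t * \<omega> (1 - t)"
        then have "c \<le> phi_f \<phi> ell Q \<epsilon> t * \<omega> (1 - t) / \<epsilon>"
          using e by (simp add: field_simps)
        then have "c * p\<^sup>2 \<le> phi_f \<phi> ell Q \<epsilon> t * \<omega> (1 - t) / \<epsilon> * p\<^sup>2"
          by (rule mult_right_mono) simp
        also have "\<dots> = 4 * (A * B)" by (simp add: A_def B_def)
        finally have "sqrt c * \<bar>p\<bar> \<le> A + B" using A0 B0 c by (intro am_gm_abs_bound) auto
        then have "sqrt c * \<bar>p\<bar> \<le> A + B + D + 1" using D0 by simp
        then show ?thesis using A0 B0 D0 c K by (intro scale[of "sqrt c"]) auto
      qed
    }
    {
      assume t: "0 \<le> t" "t \<le> 3/4"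
      have "m3 \<le> \<omega> (1 - t)" using t by (intro m3) auto
      then have "m3 * q\<^sup>2 \<le> \<omega> (1 - t) * q\<^sup>2" by (rule mult_right_mono) simp
      also have "\<dots> = 4 * (B * D)" using e by (simp add: B_def D_def)
      finally have *: "m3 * q\<^sup>2 \<le> 4 * (B * D)" .
      have B0: "0 \<le> B" using \<omega>0[of "1 - t"] t e by (simp add: B_def)
      have "sqrt m3 * \<bar>q\<bar> \<le> B + D" using * B0 D0 m3 by (intro am_gm_abs_bound) auto
      then have "sqrt m3 * \<bar>q\<bar> \<le> A + B + D + 1" using A0 by simp
      then show "\<bar>q\<bar> \<le> K * (A + B + D + 1)"
        using A0 B0 D0 m3 K by (intro scale[of "sqrt m3"]) auto
    }
  qed
qed

section \<open>Compactness and lower semicontinuity of the variation\<close>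

text \<open>The domination gives a Jordan decomposition \<open>F = G - (G - F)\<close> into
  nondecreasing functions. Helly's selection applies to both in turn, continuity supplying the
  right-continuity that it asks for, and the limits of both hold off the countably many
  discontinuities of two monotone functions.\<close>

lemma Helly_AE:
  fixes F G :: "nat \<Rightarrow> real \<Rightarrow> real"
  assumes contF: "\<And>n x. isCont (F n) x" and contG: "\<And>n x. isCont (G n) x"
    and bdF: "\<And>n x. \<bar>F n x\<bar> \<le> B" and bdG: "\<And>n x. \<bar>G n x\<bar> \<le> C"
    and var: "\<And>n s t. s \<le> t \<Longrightarrow> \<bar>F n t - F n s\<bar> \<le> G n t - G n s"
  obtains r :: "nat \<Rightarrow> nat" and Z where "strict_mono r" "AE x in lborel. (\<lambda>n. F (r n) x) \<longlonglongrightarrow> Z x"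
proof -
  have monoG: "mono (G n)" for n
    by (rule monoI) (use var[of _ _ n] in \<open>smt (verit)\<close>)
  have monoD: "mono (\<lambda>x. G n x - F n x)" for n
    by (rule monoI) (use var[of _ _ n] in \<open>smt (verit)\<close>)
  obtain r1 g where r1: "strict_mono (r1 :: nat \<Rightarrow> nat)" "mono g"
    "\<And>x. isCont g x \<Longrightarrow> (\<lambda>n. G (r1 n) x) \<longlonglongrightarrow> g x"
    using Helly_selection[of G, OF continuous_at_imp_continuous_at_within[OF contG] monoG bdG] by blast
  have bdD: "\<bar>G (r1 n) x - F (r1 n) x\<bar> \<le> C + B" for n x
    using bdF[of "r1 n" x] bdG[of "r1 n" x] by linarith
  obtain r2 d where r2: "strict_mono (r2 :: nat \<Rightarrow> nat)" "mono d"
    "\<And>x. isCont d x \<Longrightarrow> (\<lambda>n. G (r1 (r2 n)) x - F (r1 (r2 n)) x) \<longlonglongrightarrow> d x"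
    using Helly_selection[of "\<lambda>n x. G (r1 n) x - F (r1 n) x",
        OF continuous_at_imp_continuous_at_within[OF continuous_diff[OF contG contF]] monoD bdD] by blast
  have "countable ({x. \<not> isCont g x} \<union> {x. \<not> isCont d x})"
    using mono_ctble_discont[OF r1(2)] mono_ctble_discont[OF r2(2)] by simp
  then have "AE x in lborel. x \<notin> {x. \<not> isCont g x} \<union> {x. \<not> isCont d x}"
    by (intro AE_not_in countable_imp_null_set_lborel)
  then have "AE x in lborel. (\<lambda>n. F ((r1 \<circ> r2) n) x) \<longlonglongrightarrow> g x - d x"
  proof eventually_elim
    case (elim x)
    then have "(\<lambda>n. G (r1 (r2 n)) x) \<longlonglongrightarrow> g x"
      using LIMSEQ_subseq_LIMSEQ[OF r1(3) r2(1), of x] by (simp add: o_def)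
    from tendsto_diff[OF this r2(3)[of x]] elim show ?case by simp
  qed
  then show ?thesis using strict_mono_o[OF r1(1) r2(1)] by (intro that)
qed

section \<open>Test functions and lower semicontinuity of the total variation\<close>

lemma C1c_properties:
  assumes "\<psi> \<in> C1c V"
  obtains r K where "0 < r" "0 < K" "\<And>x. r < \<bar>x\<bar> \<Longrightarrow> \<psi> x = 0"
    "\<And>x. x \<notin> V \<Longrightarrow> deriv \<psi> x = 0"
    "\<And>x. (\<psi> has_real_derivative deriv \<psi> x) (at x)" "\<And>x. \<bar>deriv \<psi> x\<bar> \<le> K"
    "continuous_on UNIV (deriv \<psi>)"
proof -
  define S where "S = closure {x. \<psi> x \<noteq> 0}"
  have C1: "\<psi> C1_differentiable_on UNIV" and comp: "compact S" and sub: "S \<subseteq> V"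
    using assms by (auto simp: C1c_def S_def)
  from C1 obtain D where D: "\<And>x. (\<psi> has_vector_derivative D x) (at x)" "continuous_on UNIV D"
    by (auto simp: C1_differentiable_on_def)
  have "deriv \<psi> = D"
    using D(1) by (auto simp: has_real_derivative_iff_has_vector_derivative[symmetric] DERIV_imp_deriv)
  with D have der: "(\<psi> has_real_derivative deriv \<psi> x) (at x)" and cont: "continuous_on UNIV (deriv \<psi>)" for x
    by (auto simp: has_real_derivative_iff_has_vector_derivative)
  have zero: "\<psi> x = 0" if "x \<notin> S" for x
    using that closure_subset[of "{x. \<psi> x \<noteq> 0}"] by (auto simp: S_def)
  have dzero: "deriv \<psi> x = 0" if "x \<notin> S" for x
  proof -
    have "((\<lambda>_. 0) has_real_derivative deriv \<psi> x) (at x)"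
    proof (rule has_field_derivative_transform_within_open[OF der, of "- S"])
      show "open (- S)" by (simp add: S_def open_Compl)
      show "x \<in> - S" using that by simp
      show "\<psi> y = 0" if "y \<in> - S" for y using zero[of y] that by simp
    qed
    then show ?thesis using DERIV_const DERIV_unique by blast
  qed
  from compact_imp_bounded[OF comp] obtain r where r: "r > 0" "\<And>x. x \<in> S \<Longrightarrow> \<bar>x\<bar> \<le> r"
    unfolding bounded_pos by auto
  have "bounded (deriv \<psi> ` S)"
    by (intro compact_imp_bounded compact_continuous_image continuous_on_subset[OF cont] comp) auto
  then obtain K where K: "K > 0" "\<forall>x\<in>S. \<bar>deriv \<psi> x\<bar> \<le> K"
    unfolding bounded_pos by auto
  show ?thesis
  proof (rule that[OF r(1) K(1)])
    show "\<psi> x = 0" if "r < \<bar>x\<bar>" for x using that r(2)[of x] zero by force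
    show "deriv \<psi> x = 0" if "x \<notin> V" for x using that sub dzero by auto
    show "\<bar>deriv \<psi> x\<bar> \<le> K" for x using K dzero[of x] by (cases "x \<in> S") auto
  qed (use der cont in auto)
qed

text \<open>Tonelli: a point \<open>y\<close> lies in \<open>{x-h<..x}\<close> exactly for
  \<open>x\<close> in \<open>{y..<y+h}\<close>, a set of length \<open>h\<close>.\<close>

lemma nn_integral_primitive_increment:
  assumes H: "integrable lborel H" "\<And>y. 0 \<le> H y" and "0 < h"
  shows "(\<integral>\<^sup>+x. ennreal (primitive H x - primitive H (x - h)) \<partial>lborel) = ennreal (h * (\<integral>y. H y \<partial>lborel))"
proof -
  note [measurable] = borel_measurable_integrable[OF H(1)]
  have "ennreal (primitive H x - primitive H (x - h))
      = (\<integral>\<^sup>+y. ennreal (H y) * (if x - h < y \<and> y \<le> x then 1 else 0) \<partial>lborel)" for x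
  proof -
    have "primitive H x - primitive H (x - h) = (\<integral>y. indicator {x-h<..x} y * H y \<partial>lborel)"
      using \<open>0 < h\<close> by (intro primitive_diff H) simp
    also have "ennreal \<dots> = (\<integral>\<^sup>+y. ennreal (indicator {x-h<..x} y * H y) \<partial>lborel)"
      by (rule nn_integral_eq_integral[symmetric])
         (auto intro!: integrable_indicator_times H AE_I2 mult_nonneg_nonneg)
    also have "\<dots> = (\<integral>\<^sup>+y. ennreal (H y) * (if x - h < y \<and> y \<le> x then 1 else 0) \<partial>lborel)"
      by (intro nn_integral_cong) (auto split: split_indicator)
    finally show ?thesis .
  qed
  then have "(\<integral>\<^sup>+x. ennreal (primitive H x - primitive H (x - h)) \<partial>lborel)
      = (\<integral>\<^sup>+x. (\<integral>\<^sup>+y. ennreal (H y) * (if x - h < y \<and> y \<le> x then 1 else 0) \<partial>lborel) \<partial>lborel)"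
    by simp
  also have "\<dots> = (\<integral>\<^sup>+y. (\<integral>\<^sup>+x. ennreal (H y) * (if x - h < y \<and> y \<le> x then 1 else 0) \<partial>lborel) \<partial>lborel)"
    by (rule lborel_pair.Fubini'[symmetric]) measurable
  also have "\<dots> = (\<integral>\<^sup>+y. ennreal h * ennreal (H y) \<partial>lborel)"
  proof (rule nn_integral_cong)
    fix y
    have "(\<integral>\<^sup>+x. ennreal (H y) * (if x - h < y \<and> y \<le> x then 1 else 0) \<partial>lborel)
        = (\<integral>\<^sup>+x. ennreal (H y) * indicator {y..<y+h} x \<partial>lborel)"
      by (intro nn_integral_cong) (auto split: split_indicator)
    also have "\<dots> = ennreal h * ennreal (H y)"
      using \<open>0 < h\<close> by (simp add: nn_integral_cmult_indicator mult.commute)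
    finally show "(\<integral>\<^sup>+x. ennreal (H y) * (if x - h < y \<and> y \<le> x then 1 else 0) \<partial>lborel)
        = ennreal h * ennreal (H y)" .
  qed
  also have "\<dots> = ennreal h * (\<integral>\<^sup>+y. ennreal (H y) \<partial>lborel)"
    by (rule nn_integral_cmult) measurable
  also have "\<dots> = ennreal (h * (\<integral>y. H y \<partial>lborel))"
    using H \<open>0 < h\<close> by (simp add: nn_integral_eq_integral ennreal_mult'')
  finally show ?thesis .
qed

text \<open>Integration by parts in discrete form, since \<open>F\<close> is not differentiated. The
  derivative of \<psi> is replaced by a difference quotient, a translation moves the difference onto
  \<open>F\<close>, and the increments of \<open>F\<close> are dominated by those of
  \<open>primitive H\<close>, whose integral is \<open>h\<close> times that of \<open>H\<close>.
  Then \<open>h\<close> tends to 0.\<close>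

lemma test_integral_bound:
  assumes H: "integrable lborel H" "\<And>y. 0 \<le> H y"
    and F: "continuous_on UNIV F" "\<And>x. \<bar>F x\<bar> \<le> B"
    and var: "\<And>s t. s \<le> t \<Longrightarrow> \<bar>F t - F s\<bar> \<le> primitive H t - primitive H s"
    and \<psi>: "\<psi> \<in> C1c V" "\<And>x. \<bar>\<psi> x\<bar> \<le> 1"
  shows "\<bar>\<integral>x. F x * deriv \<psi> x \<partial>lborel\<bar> \<le> (\<integral>y. H y \<partial>lborel)"
proof -
  obtain r K where r: "0 < r" and K: "0 < K" and supp: "\<And>x. r < \<bar>x\<bar> \<Longrightarrow> \<psi> x = 0"
    and der: "\<And>x. (\<psi> has_real_derivative deriv \<psi> x) (at x)" and dK: "\<And>x. \<bar>deriv \<psi> x\<bar> \<le> K"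
    and dcont: "continuous_on UNIV (deriv \<psi>)"
    using C1c_properties[OF \<psi>(1)] by metis
  have B: "0 \<le> B" using F(2)[of 0] by linarith
  have "continuous_on UNIV \<psi>"
    using der by (intro continuous_at_imp_continuous_on ballI DERIV_isCont) auto
  note [measurable] = borel_measurable_continuous_onI[OF this] borel_measurable_continuous_onI[OF F(1)]
    borel_measurable_continuous_onI[OF dcont]
  define Dq where "Dq h x = (\<psi> (x + h) - \<psi> x) / h" for h x :: real
  have bound: "\<bar>\<integral>x. F x * Dq h x \<partial>lborel\<bar> \<le> (\<integral>y. H y \<partial>lborel)" if h: "0 < h" "h \<le> 1" for h
  proof -
    \<comment> \<open>Shifts by at most 1 keep the support of \<psi> inside
      \<open>{-r-1..r+1}\<close>, a set that serves as a dominating support for all step sizes at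
      once.\<close>
    have i1: "integrable lborel (\<lambda>x. F x * \<psi> (x + k))" if "\<bar>k\<bar> \<le> 1" for k
    proof (rule Bochner_Integration.integrable_bound)
      show "integrable lborel (\<lambda>x. B * indicator {-r-1..r+1} x)"
        by (intro integrable_mult_right integrable_real_indicator) (auto simp: emeasure_lborel_Icc_eq)
      have "\<bar>F x * \<psi> (x + k)\<bar> \<le> B * indicator {-r-1..r+1} x" for x
      proof (cases "x \<in> {-r-1..r+1}")
        case True
        then show ?thesis using mult_mono[OF F(2)[of x] \<psi>(2)[of "x + k"]] B by (simp add: abs_mult)
      next
        case False
        with that have "r < \<bar>x + k\<bar>" by auto
        with supp False show ?thesis by simp
      qed
      then show "AE x in lborel. norm (F x * \<psi> (x + k)) \<le> norm (B * indicator {-r-1..r+1} x)"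
        using B by simp
    qed measurable
    have translate: "(\<lambda>x. F (- h + 1 * x) * \<psi> (- h + 1 * x + h)) = (\<lambda>x. F (x - h) * \<psi> x)"
      by (intro ext arg_cong2[where f = "(*)"] arg_cong[where f = F] arg_cong[where f = \<psi>]) simp_all
    have i2: "integrable lborel (\<lambda>x. F (x - h) * \<psi> x)"
      using lborel_integrable_real_affine[OF i1[of h], of 1 "- h"] h unfolding translate by simp
    have shift: "(\<integral>x. F x * \<psi> (x + h) \<partial>lborel) = (\<integral>x. F (x - h) * \<psi> x \<partial>lborel)"
      using lborel_integral_real_affine[of 1 "\<lambda>x. F x * \<psi> (x + h)" "- h"] unfolding translate by simp
    have "h * (\<integral>x. F x * Dq h x \<partial>lborel) = (\<integral>x. F x * \<psi> (x + h) - F x * \<psi> (x + 0) \<partial>lborel)"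
      unfolding integral_mult_right_zero[symmetric] Dq_def
      using h by (intro Bochner_Integration.integral_cong) (auto simp: field_simps)
    also have "\<dots> = (\<integral>x. F x * \<psi> (x + h) \<partial>lborel) - (\<integral>x. F x * \<psi> (x + 0) \<partial>lborel)"
      by (intro Bochner_Integration.integral_diff i1) (use h in auto)
    also have "\<dots> = (\<integral>x. F (x - h) * \<psi> x - F x * \<psi> x \<partial>lborel)"
      unfolding shift using i2 i1[of 0] by simp
    finally have eq: "h * (\<integral>x. F x * Dq h x \<partial>lborel) = (\<integral>x. F (x - h) * \<psi> x - F x * \<psi> x \<partial>lborel)" .
    have "integrable lborel (\<lambda>x. F (x - h) * \<psi> x - F x * \<psi> x)"
      using i2 i1[of 0] by (intro Bochner_Integration.integrable_diff) auto
    from integral_norm_bound_ennreal[OF this]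
    have "ennreal \<bar>h * (\<integral>x. F x * Dq h x \<partial>lborel)\<bar> \<le> (\<integral>\<^sup>+x. ennreal \<bar>F (x - h) * \<psi> x - F x * \<psi> x\<bar> \<partial>lborel)"
      by (simp add: eq)
    also have "\<dots> \<le> (\<integral>\<^sup>+x. ennreal (primitive H x - primitive H (x - h)) \<partial>lborel)"
    proof (intro nn_integral_mono ennreal_leI)
      fix x
      have "\<bar>F (x - h) * \<psi> x - F x * \<psi> x\<bar> = \<bar>F x - F (x - h)\<bar> * \<bar>\<psi> x\<bar>"
        unfolding abs_mult[symmetric] left_diff_distrib by (rule abs_minus_commute)
      also have "\<dots> \<le> \<bar>F x - F (x - h)\<bar> * 1"
        by (intro mult_left_mono \<psi>) auto
      also have "\<dots> \<le> primitive H x - primitive H (x - h)"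
        using var[of "x - h" x] h by simp
      finally show "\<bar>F (x - h) * \<psi> x - F x * \<psi> x\<bar> \<le> primitive H x - primitive H (x - h)" .
    qed
    also have "\<dots> = ennreal (h * (\<integral>y. H y \<partial>lborel))"
      by (rule nn_integral_primitive_increment[OF H h(1)])
    finally have "\<bar>h * (\<integral>x. F x * Dq h x \<partial>lborel)\<bar> \<le> h * (\<integral>y. H y \<partial>lborel)"
      using h H by (subst (asm) ennreal_le_iff) (auto intro!: mult_nonneg_nonneg Bochner_Integration.integral_nonneg)
    then show ?thesis using h by (simp add: abs_mult)
  qed
  define \<eta> where "\<eta> n = inverse (real (Suc n))" for n
  have \<eta>: "0 < \<eta> n" "\<eta> n \<le> 1" for n by (auto simp: \<eta>_def field_simps)
  have \<eta>_lim: "filterlim \<eta> (at 0) sequentially"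
    unfolding \<eta>_def[abs_def]
    by (rule filterlim_atI) (use LIMSEQ_inverse_real_of_nat in auto)
  have "(\<lambda>n. \<integral>x. F x * Dq (\<eta> n) x \<partial>lborel) \<longlonglongrightarrow> (\<integral>x. F x * deriv \<psi> x \<partial>lborel)"
  proof (rule integral_dominated_convergence)
    show "integrable lborel (\<lambda>x. B * K * indicator {-r-1..r+1} x)"
      by (intro integrable_mult_right integrable_real_indicator) (auto simp: emeasure_lborel_Icc_eq)
    show "AE x in lborel. (\<lambda>n. F x * Dq (\<eta> n) x) \<longlonglongrightarrow> F x * deriv \<psi> x"
    proof (intro AE_I2 tendsto_intros)
      fix x
      have "((\<lambda>h. Dq h x) \<longlongrightarrow> deriv \<psi> x) (at 0)"
        using der[of x] by (simp add: DERIV_def Dq_def)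
      then show "(\<lambda>n. Dq (\<eta> n) x) \<longlonglongrightarrow> deriv \<psi> x"
        using \<eta>_lim by (rule filterlim_compose)
    qed
    show "AE x in lborel. norm (F x * Dq (\<eta> n) x) \<le> B * K * indicator {-r-1..r+1} x" for n
    proof (intro AE_I2)
      fix x
      have "norm (\<psi> (x + \<eta> n) - \<psi> x) \<le> K * norm (x + \<eta> n - x)"
        by (rule field_differentiable_bound[of UNIV \<psi> "deriv \<psi>"]) (use der dK in auto)
      then have "\<bar>Dq (\<eta> n) x\<bar> \<le> K" using \<eta>[of n] by (simp add: Dq_def abs_mult field_simps)
      moreover have "Dq (\<eta> n) x = 0" if "x \<notin> {-r-1..r+1}"
        using that supp[of x] supp[of "x + \<eta> n"] \<eta>[of n] by (auto simp: Dq_def)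
      ultimately show "norm (F x * Dq (\<eta> n) x) \<le> B * K * indicator {-r-1..r+1} x"
        using mult_mono[OF F(2)[of x], of "\<bar>Dq (\<eta> n) x\<bar>" K] B by (simp add: abs_mult split: split_indicator)
    qed
  qed (unfold Dq_def, measurable)
  then have "(\<lambda>n. \<bar>\<integral>x. F x * Dq (\<eta> n) x \<partial>lborel\<bar>) \<longlonglongrightarrow> \<bar>\<integral>x. F x * deriv \<psi> x \<partial>lborel\<bar>"
    by (rule tendsto_rabs)
  then show ?thesis
    by (rule tendsto_upperbound) (use bound \<eta> in auto)
qed

lemma AE_lebesgue_on_iff_lborel:
  assumes "S \<in> sets borel"
  shows "(AE x in lebesgue_on S. P x) \<longleftrightarrow> (AE x in lborel. x \<in> S \<longrightarrow> P x)"
  using assms by (simp add: AE_restrict_space_iff AE_completion_iff)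

lemma borel_measurable_lebesgue_on_borel:
  assumes "f \<in> borel_measurable borel"
  shows "f \<in> borel_measurable (lebesgue_on S)"
  using assms by (intro measurable_restrict_space1 measurable_completion) simp

text \<open>Total variation is a supremum of integrals against fixed test functions. Each of them
  passes to the limit by dominated convergence, and \<open>test_integral_bound\<close> bounds it by
  \<open>C\<close> uniformly in \<open>k\<close> and in \<open>V\<close>.\<close>

lemma BV_loc_limit:
  fixes F H :: "nat \<Rightarrow> real \<Rightarrow> real"
  assumes w: "w \<in> borel_measurable (lebesgue_on \<Omega>)" "\<And>x. \<bar>w x\<bar> \<le> M"
    and H: "\<And>k. integrable lborel (H k)" "\<And>k y. 0 \<le> H k y" "\<And>k. (\<integral>y. H k y \<partial>lborel) \<le> C"
    and F: "\<And>k. continuous_on UNIV (F k)" "\<And>k x. \<bar>F k x\<bar> \<le> M"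
    and var: "\<And>k s t. s \<le> t \<Longrightarrow> \<bar>F k t - F k s\<bar> \<le> primitive (H k) t - primitive (H k) s"
    and lim: "AE x in lborel. x \<in> \<Omega> \<longrightarrow> (\<lambda>k. F k x) \<longlonglongrightarrow> w x"
  shows "w \<in> BV_loc \<Omega>"
  unfolding BV_loc_def
proof (intro CollectI conjI allI impI; (elim conjE)?)
  show "w \<in> L1_loc \<Omega>"
    unfolding L1_loc_def
  proof (intro CollectI allI impI; elim conjE)
    fix K assume K: "compact K" "K \<subseteq> \<Omega>"
    then interpret finite_measure "lebesgue_on K"
      by (intro finite_measure_lebesgue_on lmeasurable_compact)
    show "integrable (lebesgue_on K) w"
      by (rule integrable_const_bound[of _ M])
         (use w measurable_restrict_mono[OF w(1) K(2)] in auto)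
  qed
next
  fix V assume V: "open V" "compact (closure V)" "closure V \<subseteq> \<Omega>"
  have sub: "V \<subseteq> \<Omega>" using V closure_subset by blast
  have "bounded V" using V(2) compact_imp_bounded bounded_subset closure_subset by blast
  then have "V \<in> lmeasurable" using V(1) by (rule lmeasurable_open)
  then interpret finite_measure "lebesgue_on V"
    by (rule finite_measure_lebesgue_on)
  have "total_variation V w \<le> ereal C"
    unfolding total_variation_def
  proof (intro SUP_least; clarify)
    fix \<psi> assume \<psi>: "\<psi> \<in> C1c V" "\<forall>x. \<bar>\<psi> x\<bar> \<le> 1"
    obtain K where K: "0 < K" and zero: "\<And>x. x \<notin> V \<Longrightarrow> deriv \<psi> x = 0"
      and dK: "\<And>x. \<bar>deriv \<psi> x\<bar> \<le> K" and dcont: "continuous_on UNIV (deriv \<psi>)"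
      using C1c_properties[OF \<psi>(1)] by metis
    note [measurable] = borel_measurable_continuous_onI[OF dcont] borel_measurable_continuous_onI[OF F(1)]
    have "(\<integral>x. F k x * deriv \<psi> x \<partial>lebesgue_on V) = (\<integral>x. F k x * deriv \<psi> x \<partial>lborel)" for k
      by (rule integral_lebesgue_on_eq_lborel) (use zero V(1) in auto)
    moreover have "\<bar>\<integral>x. F k x * deriv \<psi> x \<partial>lborel\<bar> \<le> C" for k
      using test_integral_bound[OF H(1,2) F var \<psi>(1)] \<psi>(2) H(3)[of k] by (meson order_trans)
    ultimately have le: "(\<integral>x. F k x * deriv \<psi> x \<partial>lebesgue_on V) \<le> C" for k
      by (metis abs_le_D1)
    have "(\<lambda>k. \<integral>x. F k x * deriv \<psi> x \<partial>lebesgue_on V) \<longlonglongrightarrow> (\<integral>x. w x * deriv \<psi> x \<partial>lebesgue_on V)"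
    proof (rule integral_dominated_convergence)
      show "integrable (lebesgue_on V) (\<lambda>x. M * K)" by simp
      show "(\<lambda>x. w x * deriv \<psi> x) \<in> borel_measurable (lebesgue_on V)"
        by (intro borel_measurable_times measurable_restrict_mono[OF w(1) sub]
            borel_measurable_lebesgue_on_borel) measurable
      show "(\<lambda>x. F k x * deriv \<psi> x) \<in> borel_measurable (lebesgue_on V)" for k
        by (intro borel_measurable_lebesgue_on_borel) measurable
      have "V \<in> sets borel" using V(1) by simp
      then show "AE x in lebesgue_on V. (\<lambda>k. F k x * deriv \<psi> x) \<longlonglongrightarrow> w x * deriv \<psi> x"
        unfolding AE_lebesgue_on_iff_lborel[OF \<open>V \<in> sets borel\<close>]
        using lim by eventually_elim (use sub in \<open>auto intro!: tendsto_intros\<close>)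
      show "AE x in lebesgue_on V. norm (F k x * deriv \<psi> x) \<le> M * K" for k
      proof (intro AE_I2)
        fix x
        have "0 \<le> M" using w(2)[of 0] by linarith
        then show "norm (F k x * deriv \<psi> x) \<le> M * K"
          using mult_mono[OF F(2)[of k x] dK[of x]] by (simp add: abs_mult)
      qed
    qed
    then have "(\<integral>x. w x * deriv \<psi> x \<partial>lebesgue_on V) \<le> C"
      by (rule tendsto_upperbound) (use le in auto)
    then show "ereal (\<integral>x. w x * deriv \<psi> x \<partial>lebesgue_on V) \<le> ereal C" by simp
  qed
  then show "total_variation V w < \<infinity>"
    using less_ereal.simps(4) order_le_less_trans by blast
qed

section \<open>Fatou bounds and Vitali convergence in L^1\<close>

lemma L1_norm_indicator:
  assumes "\<Omega> \<in> sets lebesgue" "A \<in> sets lebesgue" "A \<subseteq> \<Omega>"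
  shows "L1_norm A f = (\<integral>\<^sup>+x. ennreal \<bar>f x\<bar> * indicator A x \<partial>lebesgue_on \<Omega>)"
proof -
  have "L1_norm A f = (\<integral>\<^sup>+x. ennreal \<bar>f x\<bar> * indicator A x \<partial>lebesgue)"
    unfolding L1_norm_def by (rule nn_integral_restrict_space) (use assms in auto)
  also have "\<dots> = (\<integral>\<^sup>+x. ennreal \<bar>f x\<bar> * indicator A x * indicator \<Omega> x \<partial>lebesgue)"
    using assms(3) by (intro nn_integral_cong) (auto split: split_indicator)
  also have "\<dots> = (\<integral>\<^sup>+x. ennreal \<bar>f x\<bar> * indicator A x \<partial>lebesgue_on \<Omega>)"
    by (rule nn_integral_restrict_space[symmetric]) (use assms in auto)
  finally show ?thesis .
qed

lemma nn_integral_Fatou_bound: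
  fixes w :: "'a \<Rightarrow> real"
  assumes u: "\<And>k. u k \<in> borel_measurable M" and "\<And>k. (\<integral>\<^sup>+x. ennreal \<bar>u k x\<bar> * indicator A x \<partial>M) \<le> c"
    and A: "A \<in> sets M" and lim: "AE x in M. (\<lambda>k. u k x) \<longlonglongrightarrow> w x"
  shows "(\<integral>\<^sup>+x. ennreal \<bar>w x\<bar> * indicator A x \<partial>M) \<le> c"
proof -
  note [measurable] = u A
  have "(\<integral>\<^sup>+x. ennreal \<bar>w x\<bar> * indicator A x \<partial>M)
      = (\<integral>\<^sup>+x. liminf (\<lambda>k. ennreal \<bar>u k x\<bar> * indicator A x) \<partial>M)"
  proof (rule nn_integral_cong_AE)
    show "AE x in M. ennreal \<bar>w x\<bar> * indicator A x = liminf (\<lambda>k. ennreal \<bar>u k x\<bar> * indicator A x)"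
      using lim
    proof eventually_elim
      case (elim x)
      then have "(\<lambda>k. ennreal \<bar>u k x\<bar> * indicator A x) \<longlonglongrightarrow> ennreal \<bar>w x\<bar> * indicator A x"
        by (auto intro!: tendsto_intros split: split_indicator)
      then show ?case by (simp add: lim_imp_Liminf)
    qed
  qed
  also have "\<dots> \<le> liminf (\<lambda>k. \<integral>\<^sup>+x. ennreal \<bar>u k x\<bar> * indicator A x \<partial>M)"
    by (intro nn_integral_liminf) measurable
  also have "\<dots> \<le> c"
    by (rule Liminf_le) (use assms(2) in auto)
  finally show ?thesis .
qed

text \<open>On the set \<open>A k\<close> where the distance to the limit is at least \<eta>,
  equi-integrability controls both functions, because the measure of \<open>A k\<close> tends to 0.
  Off \<open>A k\<close> the integrand is below \<eta>.\<close>

lemma Vitali_L1: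
  assumes \<Omega>: "\<Omega> \<in> lmeasurable" and equi: "equi_integrable \<Omega> I u" and e: "\<And>k. e k \<in> I"
    and w [measurable]: "w \<in> borel_measurable (lebesgue_on \<Omega>)"
    and lim: "AE x in lebesgue_on \<Omega>. (\<lambda>k. u (e k) x) \<longlonglongrightarrow> w x"
  shows "(\<lambda>k. L1_norm \<Omega> (\<lambda>x. u (e k) x - w x)) \<longlonglongrightarrow> 0"
proof (rule order_tendstoI)
  fix z :: ennreal assume "0 < z"
  have \<Omega>': "\<Omega> \<in> sets lebesgue" using \<Omega> by (rule fmeasurableD)
  interpret finite_measure "lebesgue_on \<Omega>" by (rule finite_measure_lebesgue_on[OF \<Omega>])
  have [measurable]: "u (e k) \<in> borel_measurable (lebesgue_on \<Omega>)" for k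
    using equi e[of k] by (auto simp: equi_integrable_def L1_def)
  define m where "m = measure lebesgue \<Omega>"
  have m: "0 \<le> m" "emeasure (lebesgue_on \<Omega>) (space (lebesgue_on \<Omega>)) = ennreal m"
    using \<Omega> \<Omega>' by (auto simp: m_def emeasure_restrict_space emeasure_eq_measure2)
  obtain z' where z': "0 < z'" "z' < z" using \<open>0 < z\<close> dense by blast
  then obtain r where r: "z' = ennreal r" "0 < r"
    by (cases z' rule: ennreal_cases) auto
  \<comment> \<open>The final estimate adds \<open>\<eta> * m\<close> from the good set and \<eta>
    twice from the bad one, in total \<open>r\<close>.\<close>
  define \<eta> where "\<eta> = r / (m + 2)"
  have \<eta>: "0 < \<eta>" using r m by (simp add: \<eta>_def)
  obtain \<delta> where \<delta>: "0 < \<delta>" "\<And>A i. A \<in> sets lebesgue \<Longrightarrow> A \<subseteq> \<Omega> \<Longrightarrow> emeasure lebesgue A < ennreal \<delta> \<Longrightarrow>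
      i \<in> I \<Longrightarrow> L1_norm A (u i) < ennreal \<eta>"
    using equi \<eta> unfolding equi_integrable_def by metis
  define A where "A k = {x \<in> space (lebesgue_on \<Omega>). \<eta> \<le> \<bar>u (e k) x - w x\<bar>}" for k
  have A [measurable]: "A k \<in> sets (lebesgue_on \<Omega>)" for k unfolding A_def by measurable
  have A': "A k \<in> sets lebesgue" "A k \<subseteq> \<Omega>" for k
    using A[of k] \<Omega>' by (auto simp: sets_restrict_space_iff)
  have "(\<lambda>k. \<integral>\<^sup>+x. indicator (A k) x \<partial>lebesgue_on \<Omega>) \<longlonglongrightarrow> (\<integral>\<^sup>+x. 0 \<partial>lebesgue_on \<Omega>)"
  proof (rule nn_integral_dominated_convergence[where w = "\<lambda>_. 1"])
    show "AE x in lebesgue_on \<Omega>. (\<lambda>k. indicator (A k) x :: ennreal) \<longlonglongrightarrow> 0"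
      using lim
    proof eventually_elim
      case (elim x)
      have "\<forall>\<^sub>F k in sequentially. dist (u (e k) x) (w x) < \<eta>"
        by (rule tendstoD[OF elim \<eta>])
      then have "\<forall>\<^sub>F k in sequentially. (indicator (A k) x :: ennreal) = 0"
        by eventually_elim (auto simp: A_def dist_real_def)
      then show ?case by (rule tendsto_eventually)
    qed
    show "(\<integral>\<^sup>+x. 1 \<partial>lebesgue_on \<Omega>) < \<infinity>" using m by simp
  qed (auto split: split_indicator)
  then have "(\<lambda>k. emeasure lebesgue (A k)) \<longlonglongrightarrow> 0"
    using A' \<Omega>' by (simp add: emeasure_restrict_space)
  then have "\<forall>\<^sub>F k in sequentially. emeasure lebesgue (A k) < ennreal \<delta>"
    using \<delta>(1) by (intro order_tendstoD(2)) auto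
  then show "\<forall>\<^sub>F k in sequentially. L1_norm \<Omega> (\<lambda>x. u (e k) x - w x) < z"
  proof eventually_elim
    case (elim k)
    \<comment> \<open>The set \<open>A k\<close> stays fixed while the index \<open>j\<close> is
      free: Fatou in \<open>j\<close> then transfers the bound to \<open>w\<close>.\<close>
    have small: "(\<integral>\<^sup>+x. ennreal \<bar>u (e j) x\<bar> * indicator (A k) x \<partial>lebesgue_on \<Omega>) \<le> ennreal \<eta>" for j
      using \<delta>(2)[OF A' elim e[of j]] L1_norm_indicator[OF \<Omega>' A'] by (simp add: less_imp_le)
    have small_w: "(\<integral>\<^sup>+x. ennreal \<bar>w x\<bar> * indicator (A k) x \<partial>lebesgue_on \<Omega>) \<le> ennreal \<eta>"
      by (rule nn_integral_Fatou_bound[OF _ small A lim]) measurable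
    have "L1_norm \<Omega> (\<lambda>x. u (e k) x - w x) \<le> (\<integral>\<^sup>+x. ennreal \<eta>
        + (ennreal \<bar>u (e k) x\<bar> * indicator (A k) x + ennreal \<bar>w x\<bar> * indicator (A k) x) \<partial>lebesgue_on \<Omega>)"
      unfolding L1_norm_def
    proof (rule nn_integral_mono)
      fix x assume x: "x \<in> space (lebesgue_on \<Omega>)"
      show "ennreal \<bar>u (e k) x - w x\<bar> \<le> ennreal \<eta>
        + (ennreal \<bar>u (e k) x\<bar> * indicator (A k) x + ennreal \<bar>w x\<bar> * indicator (A k) x)"
      proof (cases "x \<in> A k")
        case True
        have "ennreal \<bar>u (e k) x - w x\<bar> \<le> ennreal (\<eta> + (\<bar>u (e k) x\<bar> + \<bar>w x\<bar>))"
          using \<eta> by (intro ennreal_leI) linarith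
        with True show ?thesis using \<eta> by (simp add: ennreal_plus)
      next
        case False
        with x have "\<bar>u (e k) x - w x\<bar> \<le> \<eta>" by (auto simp: A_def)
        with False show ?thesis by (simp add: ennreal_leI)
      qed
    qed
    also have "\<dots> = ennreal \<eta> * ennreal m
        + ((\<integral>\<^sup>+x. ennreal \<bar>u (e k) x\<bar> * indicator (A k) x \<partial>lebesgue_on \<Omega>)
          + (\<integral>\<^sup>+x. ennreal \<bar>w x\<bar> * indicator (A k) x \<partial>lebesgue_on \<Omega>))"
      by (subst nn_integral_add; (subst nn_integral_add)?) (use m(2) in auto)
    also have "\<dots> \<le> ennreal \<eta> * ennreal m + (ennreal \<eta> + ennreal \<eta>)"
      by (intro add_mono small small_w order_refl)
    also have "\<dots> = ennreal r"
    proof -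
      have "r = \<eta> * (m + 2)" using m by (simp add: \<eta>_def)
      then have "r = \<eta> * m + (\<eta> + \<eta>)" by (simp add: algebra_simps)
      then show ?thesis
        using \<eta> m by (simp add: ennreal_mult[symmetric] ennreal_plus[symmetric] del: ennreal_plus)
    qed
    finally show "L1_norm \<Omega> (\<lambda>x. u (e k) x - w x) < z" using z' r by simp
  qed
qed simp

section \<open>Sequences of bounded energy\<close>

lemma H1_primitive:
  assumes "a < b" "u \<in> H1 {a<..<b}"
  obtains c h where "integrable lborel h" "\<And>x. x \<notin> {a<..<b} \<Longrightarrow> h x = 0"
    "AE x in lborel. x \<in> {a<..<b} \<longrightarrow> weak_deriv {a<..<b} u x = h x"
    "AE x in lborel. x \<in> {a<..<b} \<longrightarrow> u x = c + primitive h x"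
proof -
  have "\<exists>g. g \<in> L2 {a<..<b} \<and> has_weak_deriv {a<..<b} u g"
    using assms(2) by (auto simp: H1_def)
  from someI_ex[OF this]
  have wd: "weak_deriv {a<..<b} u \<in> L2 {a<..<b}" "has_weak_deriv {a<..<b} u (weak_deriv {a<..<b} u)"
    by (auto simp: weak_deriv_def)
  have "u \<in> L2 {a<..<b}" using assms(2) by (simp add: H1_def)
  from weak_deriv_primitive[OF assms(1) this wd] show ?thesis
    using that by blast
qed

lemma nn_integral_lebesgue_on_eq_lborel:
  assumes "f \<in> borel_measurable borel" "S \<in> sets borel" "\<And>x. x \<notin> S \<Longrightarrow> f x = (0 :: ennreal)"
  shows "(\<integral>\<^sup>+x. f x \<partial>lebesgue_on S) = (\<integral>\<^sup>+x. f x \<partial>lborel)"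
proof -
  have "(\<integral>\<^sup>+x. f x \<partial>lebesgue_on S) = (\<integral>\<^sup>+x. f x * indicator S x \<partial>lebesgue)"
    by (rule nn_integral_restrict_space) (use assms in auto)
  also have "\<dots> = (\<integral>\<^sup>+x. f x \<partial>lebesgue)"
    using assms(3) by (intro nn_integral_cong) (auto split: split_indicator)
  finally show ?thesis by (simp add: nn_integral_completion)
qed

text \<open>The coercivity bounds, integrated over the ranges where they hold. The data
  \<open>c\<close>, \<open>g\<close>, \<open>d\<close>, \<open>h\<close> are chosen before
  \<open>M\<close>, so one representation serves arctan, with \<open>M = pi / 2\<close>, and
  truncations at every height.\<close>

lemma finite_energy_representation:
  fixes \<epsilon> C K :: real
  assumes "a < b" "0 < \<epsilon>" "0 \<le> C" "0 < K"
    and K1: "\<And>t p q. 1/4 \<le> t \<Longrightarrow> t \<le> 1 \<Longrightarrow>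
       \<bar>p\<bar> \<le> K * (phi_f \<phi> ell Q \<epsilon> t * p\<^sup>2 + \<omega> (1 - t) / (4 * \<epsilon>) + \<epsilon> * q\<^sup>2 + 1)"
    and K2: "\<And>t p q. 0 \<le> t \<Longrightarrow> t \<le> 3/4 \<Longrightarrow>
       \<bar>q\<bar> \<le> K * (phi_f \<phi> ell Q \<epsilon> t * p\<^sup>2 + \<omega> (1 - t) / (4 * \<epsilon>) + \<epsilon> * q\<^sup>2 + 1)"
    and fin: "phase_field {a<..<b} \<phi> ell Q \<omega> \<epsilon> u v \<le> ennreal C"
  obtains c g d h where "integrable lborel g" "integrable lborel h"
    "AE x in lborel. x \<in> {a<..<b} \<longrightarrow> u x = c + primitive g x"
    "AE x in lborel. x \<in> {a<..<b} \<longrightarrow> v x = d + primitive h x"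
    "\<And>M. 0 \<le> M \<Longrightarrow> integrable lborel (\<lambda>y. (if d + primitive h y \<le> 3/4 then 8 * M * \<bar>h y\<bar> else 0)
        + (if 1/4 \<le> d + primitive h y then \<bar>g y\<bar> else 0))"
    "\<And>M. 0 \<le> M \<Longrightarrow> (\<integral>y. (if d + primitive h y \<le> 3/4 then 8 * M * \<bar>h y\<bar> else 0)
        + (if 1/4 \<le> d + primitive h y then \<bar>g y\<bar> else 0) \<partial>lborel) \<le> (8 * M + 1) * (2 * K * (C + (b - a)))"
proof -
  let ?S = "{a<..<b}"
  define E where "E x = phi_f \<phi> ell Q \<epsilon> (v x) * (weak_deriv ?S u x)\<^sup>2
               + \<omega> (1 - v x) / (4 * \<epsilon>) + \<epsilon> * (weak_deriv ?S v x)\<^sup>2" for x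
  have H1: "u \<in> H1 ?S" "v \<in> H1 ?S" and v01: "AE x in lebesgue_on ?S. v x \<in> {0..1}"
    and E: "(\<integral>\<^sup>+x. ennreal (E x) \<partial>lebesgue_on ?S) \<le> ennreal C"
    using fin unfolding phase_field_def E_def by (auto split: if_splits simp: top_unique)
  obtain c g where g: "integrable lborel g" "\<And>x. x \<notin> ?S \<Longrightarrow> g x = 0"
    "AE x in lborel. x \<in> ?S \<longrightarrow> weak_deriv ?S u x = g x"
    "AE x in lborel. x \<in> ?S \<longrightarrow> u x = c + primitive g x"
    using H1_primitive[OF \<open>a < b\<close> H1(1)] by blast
  obtain d h where h: "integrable lborel h" "\<And>x. x \<notin> ?S \<Longrightarrow> h x = 0"
    "AE x in lborel. x \<in> ?S \<longrightarrow> weak_deriv ?S v x = h x"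
    "AE x in lborel. x \<in> ?S \<longrightarrow> v x = d + primitive h x"
    using H1_primitive[OF \<open>a < b\<close> H1(2)] by blast
  have "continuous_on UNIV (primitive h)"
    by (intro continuous_at_imp_continuous_on ballI isCont_primitive h)
  note [measurable] = borel_measurable_integrable[OF g(1)] borel_measurable_integrable[OF h(1)]
    borel_measurable_continuous_onI[OF this]
  define X1 where "X1 y = (if d + primitive h y \<le> 3/4 then \<bar>h y\<bar> else 0)" for y
  define X2 where "X2 y = (if 1/4 \<le> d + primitive h y then \<bar>g y\<bar> else 0)" for y
  have [measurable]: "X1 \<in> borel_measurable borel" "X2 \<in> borel_measurable borel"
    unfolding X1_def[abs_def] X2_def[abs_def] by measurable
  have X1: "integrable lborel X1"
    by (rule Bochner_Integration.integrable_bound[OF h(1)]) (auto simp: X1_def)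
  have X2: "integrable lborel X2"
    by (rule Bochner_Integration.integrable_bound[OF g(1)]) (auto simp: X2_def)
  have X0: "0 \<le> X1 y" "0 \<le> X2 y" for y by (auto simp: X1_def X2_def)
  define X where "X y = X1 y + X2 y" for y
  have [measurable]: "X \<in> borel_measurable borel" unfolding X_def[abs_def] by measurable
  have X: "integrable lborel X" unfolding X_def[abs_def] using X1 X2 by simp
  have Xnn: "0 \<le> X y" for y using X0[of y] by (simp add: X_def)
  text \<open>Passing to \<open>X\<close> before splitting the integral makes it unnecessary to show that the
    energy density is measurable.\<close>
  have S: "?S \<in> sets borel" by simp
  have "AE x in lebesgue_on ?S. (X x - 2 * K) / (2 * K) \<le> E x"
    using v01 g(3) h(3,4) unfolding AE_lebesgue_on_iff_lborel[OF S]
  proof eventually_elim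
    case (elim x)
    show ?case
    proof
      assume "x \<in> ?S"
      with elim have v: "0 \<le> v x" "v x \<le> 1" "v x = d + primitive h x"
        and wd: "weak_deriv ?S u x = g x" "weak_deriv ?S v x = h x" by auto
      have 1: "\<bar>g x\<bar> \<le> K * (E x + 1)" if "1/4 \<le> v x"
        using K1[OF that v(2), of "g x" "h x"] by (simp add: E_def wd)
      have 2: "\<bar>h x\<bar> \<le> K * (E x + 1)" if "v x \<le> 3/4"
        using K2[OF v(1) that, of "h x" "g x"] by (simp add: E_def wd)
      \<comment> \<open>Needed where only one summand of \<open>X\<close> is active, to bound a
        single term by twice \<open>K * (E x + 1)\<close>. At least one of the two bounds applies at
        every value of \<open>v\<close>, which gives the sign.\<close>
      have "0 \<le> K * (E x + 1)"
      proof (cases "1/4 \<le> v x")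
        case True
        from order_trans[OF abs_ge_zero 1[OF this]] show ?thesis .
      next
        case False
        then have "v x \<le> 3/4" by simp
        from order_trans[OF abs_ge_zero 2[OF this]] show ?thesis .
      qed
      then have "X x \<le> 2 * (K * (E x + 1))"
        unfolding X_def X1_def X2_def v(3)[symmetric] using 1 2 by auto
      then show "(X x - 2 * K) / (2 * K) \<le> E x"
        using \<open>0 < K\<close> by (simp add: field_simps)
    qed
  qed
  then have "(\<integral>\<^sup>+x. ennreal ((X x - 2 * K) / (2 * K)) \<partial>lebesgue_on ?S) \<le> (\<integral>\<^sup>+x. ennreal (E x) \<partial>lebesgue_on ?S)"
    by (intro nn_integral_mono_AE) (auto elim!: eventually_mono intro: ennreal_leI)
  with E have E': "(\<integral>\<^sup>+x. ennreal ((X x - 2 * K) / (2 * K)) \<partial>lebesgue_on ?S) \<le> ennreal C"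
    by (rule order_trans[rotated])
  have "ennreal (\<integral>x. X x \<partial>lborel) = (\<integral>\<^sup>+x. ennreal (X x) \<partial>lborel)"
    by (rule nn_integral_eq_integral[symmetric]) (auto simp: X Xnn)
  also have "\<dots> = (\<integral>\<^sup>+x. ennreal (X x) \<partial>lebesgue_on ?S)"
    by (rule nn_integral_lebesgue_on_eq_lborel[symmetric])
       (use g(2) h(2) in \<open>auto simp: X_def X1_def X2_def\<close>)
  also have "\<dots> \<le> (\<integral>\<^sup>+x. ennreal (2 * K) * (ennreal ((X x - 2 * K) / (2 * K)) + 1) \<partial>lebesgue_on ?S)"
  proof (intro nn_integral_mono)
    fix x
    \<comment> \<open>Negative values of the quotient become 0 under \<open>ennreal\<close>; the
      maximum with 0 anticipates this and keeps the inequality valid.\<close>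
    have "X x \<le> 2 * K * (max 0 ((X x - 2 * K) / (2 * K)) + 1)"
      using \<open>0 < K\<close> by (simp add: max_def field_simps)
    then have "ennreal (X x) \<le> ennreal (2 * K * (max 0 ((X x - 2 * K) / (2 * K)) + 1))"
      by (rule ennreal_leI)
    also have "\<dots> = ennreal (2 * K) * (ennreal (max 0 ((X x - 2 * K) / (2 * K))) + 1)"
      using \<open>0 < K\<close> by (subst ennreal_mult) (auto simp: ennreal_plus)
    also have "ennreal (max 0 ((X x - 2 * K) / (2 * K))) = ennreal ((X x - 2 * K) / (2 * K))"
      by (simp add: max_def ennreal_neg)
    finally show "ennreal (X x) \<le> ennreal (2 * K) * (ennreal ((X x - 2 * K) / (2 * K)) + 1)" .
  qed
  also have "\<dots> = ennreal (2 * K) * ((\<integral>\<^sup>+x. ennreal ((X x - 2 * K) / (2 * K)) \<partial>lebesgue_on ?S) + ennreal (b - a))"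
  proof -
    have [measurable]: "X \<in> borel_measurable (lebesgue_on ?S)"
      by (rule borel_measurable_lebesgue_on_borel) measurable
    have "emeasure (lebesgue_on ?S) ?S = ennreal (b - a)"
      using \<open>a < b\<close> by (simp add: emeasure_restrict_space)
    then show ?thesis
      by (subst nn_integral_cmult, measurable) (subst nn_integral_add, auto)
  qed
  also have "\<dots> \<le> ennreal (2 * K) * (ennreal C + ennreal (b - a))"
    by (intro mult_left_mono add_mono E') auto
  also have "\<dots> = ennreal (2 * K * (C + (b - a)))"
    using \<open>0 < K\<close> \<open>0 \<le> C\<close> \<open>a < b\<close> by (simp add: ennreal_mult ennreal_plus)
  finally have intX: "(\<integral>x. X x \<partial>lborel) \<le> 2 * K * (C + (b - a))"
    using \<open>0 < K\<close> \<open>0 \<le> C\<close> \<open>a < b\<close> by (subst (asm) ennreal_le_iff) auto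
  have HM: "(\<lambda>y. (if d + primitive h y \<le> 3/4 then 8 * M * \<bar>h y\<bar> else 0)
        + (if 1/4 \<le> d + primitive h y then \<bar>g y\<bar> else 0)) = (\<lambda>y. 8 * M * X1 y + X2 y)" for M
    by (auto simp: fun_eq_iff X1_def X2_def)
  show ?thesis
  proof (rule that[OF g(1) h(1) g(4) h(4)], unfold HM)
    fix M :: real assume M: "0 \<le> M"
    show int: "integrable lborel (\<lambda>y. 8 * M * X1 y + X2 y)"
      using X1 X2 by simp
    have "(\<integral>y. 8 * M * X1 y + X2 y \<partial>lborel) \<le> (\<integral>y. (8 * M + 1) * X y \<partial>lborel)"
    proof (rule integral_mono[OF int])
      show "integrable lborel (\<lambda>y. (8 * M + 1) * X y)" using X by simp
      show "8 * M * X1 y + X2 y \<le> (8 * M + 1) * X y" for y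
        using M X0[of y] by (simp add: X_def algebra_simps)
    qed
    also have "\<dots> = (8 * M + 1) * (\<integral>y. X y \<partial>lborel)" by simp
    also have "\<dots> \<le> (8 * M + 1) * (2 * K * (C + (b - a)))"
      using M intX by (intro mult_left_mono) auto
    finally show "(\<integral>y. 8 * M * X1 y + X2 y \<partial>lborel) \<le> (8 * M + 1) * (2 * K * (C + (b - a)))" .
  qed
qed

section \<open>Pointwise convergence of the phase field and recovery of \<open>u\<close> from its
  arctangent\<close>

lemma tendsto_0_if_potential_tendsto_0:
  fixes \<omega> :: "real \<Rightarrow> real"
  assumes \<omega>: "continuous_on {0..1} \<omega>" "\<And>t. t \<in> {0<..1} \<Longrightarrow> 0 < \<omega> t"
    and t: "\<And>k. t k \<in> {0..1}" and lim: "(\<lambda>k. \<omega> (t k)) \<longlonglongrightarrow> 0"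
  shows "t \<longlonglongrightarrow> 0"
proof (rule order_tendstoI)
  fix r :: real assume "0 < r"
  obtain m where m: "0 < m" "\<And>x. x \<in> {r..1} \<Longrightarrow> m \<le> \<omega> x"
    by (rule continuous_pos_lower_bound[of r 1 \<omega>])
       (use \<open>0 < r\<close> in \<open>auto intro!: continuous_on_subset[OF \<omega>(1)] \<omega>(2)\<close>)
  have "\<forall>\<^sub>F k in sequentially. \<omega> (t k) < m"
    using lim m(1) by (rule order_tendstoD)
  then show "\<forall>\<^sub>F k in sequentially. t k < r"
  proof eventually_elim
    case (elim k)
    with m(2)[of "t k"] t[of k] show ?case by force
  qed
next
  fix r :: real assume "r < 0"
  then show "\<forall>\<^sub>F k in sequentially. r < t k" using t by (auto intro!: always_eventually intro: less_le_trans)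
qed

text \<open>Summable bounds replace the extraction of a subsequence: the series of the potentials
  has finite integral, so it converges almost everywhere and its terms tend to 0.\<close>

lemma AE_phase_tendsto_1:
  fixes v :: "nat \<Rightarrow> real \<Rightarrow> real"
  assumes \<omega>: "continuous_on {0..1} \<omega>" "\<And>t. t \<in> {0<..1} \<Longrightarrow> 0 < \<omega> t" "\<omega> 0 = 0"
    and v: "\<And>k. v k \<in> borel_measurable M" "\<And>k. AE x in M. v k x \<in> {0..1}"
    and bd: "\<And>k. (\<integral>\<^sup>+x. ennreal (\<omega> (1 - v k x)) \<partial>M) \<le> ennreal (s k)"
    and s: "summable s" "\<And>k. 0 \<le> s k"
  shows "AE x in M. (\<lambda>k. v k x) \<longlonglongrightarrow> 1"
proof -
  \<comment> \<open>\<omega> is continuous only on \<open>{0..1}\<close>. Clamping the argument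
    yields a continuous function on the line, hence measurability, and changes nothing where
    \<open>v k x\<close> lies in \<open>{0..1}\<close>.\<close>
  define f where "f k x = \<omega> (max 0 (min 1 (1 - v k x)))" for k x
  have "continuous_on UNIV (\<lambda>t. \<omega> (max 0 (min 1 (1 - t))))"
    by (intro continuous_on_compose2[OF \<omega>(1)] continuous_intros) auto
  then have [measurable]: "f k \<in> borel_measurable M" for k
    unfolding f_def[abs_def]
    using measurable_compose[OF v(1) borel_measurable_continuous_onI] by blast
  have \<omega>0: "0 \<le> \<omega> t" if "t \<in> {0..1}" for t
    using \<omega>(2)[of t] \<omega>(3) that by (cases "t = 0") (auto simp: less_le)
  have f0: "0 \<le> f k x" for k x unfolding f_def by (rule \<omega>0) auto
  have "(\<integral>\<^sup>+x. ennreal (f k x) \<partial>M) = (\<integral>\<^sup>+x. ennreal (\<omega> (1 - v k x)) \<partial>M)" for k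
    by (rule nn_integral_cong_AE) (use v(2)[of k] in eventually_elim, auto simp: f_def max_def min_def)
  then have "(\<integral>\<^sup>+x. (\<Sum>k. ennreal (f k x)) \<partial>M) \<le> (\<Sum>k. ennreal (s k))"
    using bd by (subst nn_integral_suminf) (auto intro!: suminf_le)
  also have "\<dots> < \<infinity>"
    unfolding infinity_ennreal_def less_top[symmetric] by (rule ennreal_suminf_neq_top[OF s])
  finally have "(\<integral>\<^sup>+x. (\<Sum>k. ennreal (f k x)) \<partial>M) \<noteq> \<infinity>" by simp
  then have "AE x in M. (\<Sum>k. ennreal (f k x)) \<noteq> \<infinity>"
    by (intro nn_integral_PInf_AE) measurable
  moreover have "AE x in M. \<forall>k. v k x \<in> {0..1}"
    using v(2) by (subst AE_all_countable) auto
  ultimately show ?thesis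
  proof eventually_elim
    case (elim x)
    have "summable (\<lambda>k. f k x)"
      using elim(1) unfolding infinity_ennreal_def by (rule summable_suminf_not_top[OF f0])
    then have "(\<lambda>k. f k x) \<longlonglongrightarrow> 0" by (rule summable_LIMSEQ_zero)
    moreover have "(\<lambda>k. f k x) = (\<lambda>k. \<omega> (1 - v k x))"
      using elim(2) by (simp add: f_def)
    ultimately have lim: "(\<lambda>k. \<omega> (1 - v k x)) \<longlonglongrightarrow> 0" by (simp only:)
    have v': "1 - v k x \<in> {0..1}" for k using elim(2) by simp
    have "(\<lambda>k. 1 - v k x) \<longlonglongrightarrow> 0"
      by (rule tendsto_0_if_potential_tendsto_0[OF \<omega>(1,2) v' lim])
    from tendsto_diff[OF tendsto_const[of 1] this] show ?case by simp
  qed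
qed

text \<open>The only danger is a limit of modulus \<open>pi / 2\<close>. A finite liminf keeps
  \<open>|y k|\<close> below some \<open>R\<close> infinitely often, so
  \<open>|z| \<le> arctan R < pi / 2\<close>, and tan is continuous at \<open>z\<close>.\<close>

lemma arctan_limit_imp_convergent:
  fixes y :: "nat \<Rightarrow> real"
  assumes lim: "(\<lambda>k. arctan (y k)) \<longlonglongrightarrow> z" and fin: "liminf (\<lambda>k. ennreal \<bar>y k\<bar>) \<noteq> \<infinity>"
  shows "y \<longlonglongrightarrow> tan z"
proof -
  obtain R where R: "liminf (\<lambda>k. ennreal \<bar>y k\<bar>) < ennreal R" "0 < R"
  proof -
    obtain q where q: "liminf (\<lambda>k. ennreal \<bar>y k\<bar>) = ennreal q" "0 \<le> q"
      using fin by (cases "liminf (\<lambda>k. ennreal \<bar>y k\<bar>)") auto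
    show ?thesis by (rule that[of "q + 1"]) (use q in \<open>auto simp: ennreal_less_iff\<close>)
  qed
  have freq: "\<exists>\<^sub>F k in sequentially. \<bar>y k\<bar> \<le> R"
  proof (rule ccontr)
    assume "\<not> ?thesis"
    then have "\<forall>\<^sub>F k in sequentially. ennreal R \<le> ennreal \<bar>y k\<bar>"
      unfolding not_frequently by eventually_elim (auto intro: ennreal_leI)
    then have "ennreal R \<le> liminf (\<lambda>k. ennreal \<bar>y k\<bar>)" by (rule Liminf_bounded)
    with R show False by simp
  qed
  have "\<bar>z\<bar> \<le> arctan R"
  proof (rule ccontr)
    assume "\<not> ?thesis"
    then have "\<forall>\<^sub>F k in sequentially. arctan R < \<bar>arctan (y k)\<bar>"
      using tendsto_rabs[OF lim] by (intro order_tendstoD(1)) auto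
    then have "\<forall>\<^sub>F k in sequentially. \<not> \<bar>y k\<bar> \<le> R"
    proof eventually_elim
      case (elim k)
      have "\<bar>arctan (y k)\<bar> = arctan \<bar>y k\<bar>" by (auto simp: abs_if arctan_minus)
      with elim show ?case by (simp add: arctan_less_iff)
    qed
    with freq show False by (simp add: frequently_def)
  qed
  also have "\<dots> < pi / 2" by (rule arctan_ubound)
  finally have "- (pi / 2) < z" "z < pi / 2" by linarith+
  then have "cos z \<noteq> 0" using cos_gt_zero_pi[of z] by simp
  then have "isCont tan z" by simp
  from isCont_tendsto_compose[OF this lim] show ?thesis by (simp add: tan_arctan)
qed

lemma abs_arctan_diff_le: "\<bar>arctan x - arctan y\<bar> \<le> \<bar>x - y\<bar>"
proof -
  have "norm (arctan x - arctan y) \<le> 1 * norm (x - y)"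
  proof (rule field_differentiable_bound[of UNIV])
    show "(arctan has_field_derivative inverse (1 + z\<^sup>2)) (at z within UNIV)" for z
      by (auto intro: DERIV_arctan)
    show "norm (inverse (1 + z\<^sup>2)) \<le> 1" for z :: real
      by (simp add: inverse_le_1_iff add_nonneg_nonneg)
  qed auto
  then show ?thesis by simp
qed

theorem theorem3p1:
  fixes a b \<sigma> :: real
    and \<Omega> :: "real set"
    and ell Q \<omega> \<phi> :: "real \<Rightarrow> real"
    and u v :: "real \<Rightarrow> real \<Rightarrow> real"
  assumes "a < b" and "\<Omega> = {a<..<b}"
    and "continuous_on {0..1} ell" and "\<forall>t\<in>{0..1}. 0 \<le> ell t"
    and "continuous_on {0..1} Q" and "\<forall>t\<in>{0..1}. 0 \<le> Q t"
    and "ell 1 = 1"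
    and "{t\<in>{0..1}. ell t = 0} = {0}" and "{t\<in>{0..1}. Q t = 0} = {0}"
    and "\<exists>\<delta>\<in>{0<..1}. mono_on {0..\<delta>} Q"
    and "\<exists>\<delta>\<in>{0<..1}. mono_on {1 - \<delta>..<1} (f_deg ell Q)"
    and "continuous_on {0..1} \<omega>" and "\<forall>t\<in>{0..1}. 0 \<le> \<omega> t"
    and "{t\<in>{0..1}. \<omega> t = 0} = {0}"
    and "((\<lambda>t. sqrt (\<omega> t / Q t)) \<longlongrightarrow> \<sigma>) (at_right 0)" and "0 < \<sigma>"
    and "continuous_on {0..} \<phi>" and "\<forall>t\<ge>0. 0 \<le> \<phi> t" and "mono_on {0..} \<phi>"
    and "\<exists>L>0. (\<phi> \<longlongrightarrow> L) at_top"
    and "{t\<in>{0..}. \<phi> t = 0} = {0}"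
    and "\<exists>d>0. (\<phi> has_real_derivative d) (at_right 0)"
    and "\<forall>\<epsilon>>0. u \<epsilon> \<in> L1 \<Omega> \<and> v \<epsilon> \<in> L1 \<Omega>"
    and "(SUP \<epsilon>\<in>{0<..}. phase_field \<Omega> \<phi> ell Q \<omega> \<epsilon> (u \<epsilon>) (v \<epsilon>) + L1_norm \<Omega> (u \<epsilon>)) < \<infinity>"
  shows "\<exists>(e :: nat \<Rightarrow> real) w.
     (\<forall>k. 0 < e k) \<and> e \<longlonglongrightarrow> 0 \<and> w \<in> L1 \<Omega> \<inter> GBV \<Omega> \<and>
     (AE x in lebesgue_on \<Omega>. (\<lambda>k. u (e k) x) \<longlonglongrightarrow> w x \<and> (\<lambda>k. v (e k) x) \<longlonglongrightarrow> 1) \<and>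
     (equi_integrable \<Omega> {0<..} u \<longrightarrow> (\<lambda>k. L1_norm \<Omega> (\<lambda>x. u (e k) x - w x)) \<longlonglongrightarrow> 0)"
proof -
  have pos: "0 < p t" if "{t\<in>{0..1}. p t = 0} = {0}" "\<forall>t\<in>{0..1}. 0 \<le> p t" "t \<in> {0<..1}"
    for p :: "real \<Rightarrow> real" and t
    using that by (auto simp: less_le set_eq_iff)
  have \<omega>0: "\<omega> 0 = 0" and \<phi>0: "\<phi> 0 = 0" using assms(14,21) by (auto simp: set_eq_iff)
  have \<phi>pos: "0 < \<phi> t" if "0 < t" for t
    using that assms(18,21) by (auto simp: less_le set_eq_iff)
  obtain L where L: "(\<phi> \<longlongrightarrow> L) at_top" "0 < L" using assms(20) by auto
  obtain d\<phi> where d\<phi>: "(\<phi> has_real_derivative d\<phi>) (at_right 0)" "0 < d\<phi>" using assms(22) by auto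
  obtain K where K: "0 < K"
    "\<And>\<epsilon> t p q. 0 < \<epsilon> \<Longrightarrow> 1/4 \<le> t \<Longrightarrow> t \<le> 1 \<Longrightarrow>
       \<bar>p\<bar> \<le> K * (phi_f \<phi> ell Q \<epsilon> t * p\<^sup>2 + \<omega> (1 - t) / (4 * \<epsilon>) + \<epsilon> * q\<^sup>2 + 1)"
    "\<And>\<epsilon> t p q. 0 < \<epsilon> \<Longrightarrow> 0 \<le> t \<Longrightarrow> t \<le> 3/4 \<Longrightarrow>
       \<bar>q\<bar> \<le> K * (phi_f \<phi> ell Q \<epsilon> t * p\<^sup>2 + \<omega> (1 - t) / (4 * \<epsilon>) + \<epsilon> * q\<^sup>2 + 1)"
    using phase_field_coercive[OF assms(3) pos[OF assms(8,4)] assms(5) pos[OF assms(9,6)]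
        assms(12) pos[OF assms(14,13)] \<omega>0 assms(15,16,19) \<phi>0 \<phi>pos L d\<phi>] by blast
  have \<Omega>: "\<Omega> \<in> sets borel" "\<Omega> \<in> sets lebesgue" "\<Omega> \<in> lmeasurable"
    using assms(2) by auto
  define C where "C = enn2real (SUP \<epsilon>\<in>{0<..}. phase_field \<Omega> \<phi> ell Q \<omega> \<epsilon> (u \<epsilon>) (v \<epsilon>) + L1_norm \<Omega> (u \<epsilon>))"
  have C0: "0 \<le> C" by (simp add: C_def)
  have bound: "phase_field \<Omega> \<phi> ell Q \<omega> \<epsilon> (u \<epsilon>) (v \<epsilon>) + L1_norm \<Omega> (u \<epsilon>) \<le> ennreal C" if "0 < \<epsilon>" for \<epsilon>
    unfolding C_def using that assms(24) by (subst ennreal_enn2real) (auto intro: SUP_upper)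
  have pf: "phase_field \<Omega> \<phi> ell Q \<omega> \<epsilon> (u \<epsilon>) (v \<epsilon>) \<le> ennreal C"
    and L1u: "L1_norm \<Omega> (u \<epsilon>) \<le> ennreal C" if "0 < \<epsilon>" for \<epsilon>
    using order_trans[OF _ bound[OF that]] by (simp_all add: add_increasing add_increasing2)
  have u_meas: "u \<epsilon> \<in> borel_measurable (lebesgue_on \<Omega>)" and v_meas: "v \<epsilon> \<in> borel_measurable (lebesgue_on \<Omega>)"
    if "0 < \<epsilon>" for \<epsilon> using that assms(23) by (auto simp: L1_def)

  \<comment> \<open>A geometric sequence, because the potentials are bounded by multiples of
    \<epsilon> and \<open>AE_phase_tendsto_1\<close> needs summability.\<close>
  define e0 where "e0 k = (1 / 2 :: real) ^ k" for k
  have e0: "0 < e0 k" for k by (simp add: e0_def)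
  define HM where "HM d g h M y = (if d + primitive h y \<le> 3/4 then 8 * M * \<bar>h y\<bar> else 0)
    + (if 1/4 \<le> d + primitive h y then \<bar>g y\<bar> else 0)" for d M y :: real and g h :: "real \<Rightarrow> real"
  define B where "B M = (8 * M + 1) * (2 * K * (C + (b - a)))" for M
  have "\<exists>c g d h. integrable lborel g \<and> integrable lborel h \<and>
      (AE x in lborel. x \<in> \<Omega> \<longrightarrow> u (e0 k) x = c + primitive g x) \<and>
      (AE x in lborel. x \<in> \<Omega> \<longrightarrow> v (e0 k) x = d + primitive h x) \<and>
      (\<forall>M\<ge>0. integrable lborel (HM d g h M) \<and> (\<integral>y. HM d g h M y \<partial>lborel) \<le> B M)" for k
  proof -
    note rep = finite_energy_representation[where \<phi> = \<phi> and ell = ell and Q = Q and \<omega> = \<omega>,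
        OF assms(1) e0[of k] C0 K(1) K(2)[OF e0[of k]] K(3)[OF e0[of k]] pf[OF e0[of k], unfolded assms(2)],
        folded HM_def B_def]
    show ?thesis
    proof (rule rep)
      fix c g d h
      assume "integrable lborel g" "integrable lborel h"
        "AE x in lborel. x \<in> {a<..<b} \<longrightarrow> u (e0 k) x = c + primitive g x"
        "AE x in lborel. x \<in> {a<..<b} \<longrightarrow> v (e0 k) x = d + primitive h x"
        "\<And>M. 0 \<le> M \<Longrightarrow> integrable lborel (\<lambda>y. HM d g h M y)"
        "\<And>M. 0 \<le> M \<Longrightarrow> (\<integral>y. HM d g h M y \<partial>lborel) \<le> B M"
      then show ?thesis unfolding assms(2) by (intro exI[of _ c] exI[of _ g] exI[of _ d] exI[of _ h]) simp
    qed
  qed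
  then have "\<forall>k. \<exists>c g d h. integrable lborel g \<and> integrable lborel h \<and>
      (AE x in lborel. x \<in> \<Omega> \<longrightarrow> u (e0 k) x = c + primitive g x) \<and>
      (AE x in lborel. x \<in> \<Omega> \<longrightarrow> v (e0 k) x = d + primitive h x) \<and>
      (\<forall>M\<ge>0. integrable lborel (HM d g h M) \<and> (\<integral>y. HM d g h M y \<partial>lborel) \<le> B M)" by (rule allI)
  from this[unfolded choice_iff] obtain c g d h where
    all: "\<forall>k. integrable lborel (g k) \<and> integrable lborel (h k) \<and>
      (AE x in lborel. x \<in> \<Omega> \<longrightarrow> u (e0 k) x = c k + primitive (g k) x) \<and>
      (AE x in lborel. x \<in> \<Omega> \<longrightarrow> v (e0 k) x = d k + primitive (h k) x) \<and>
      (\<forall>M\<ge>0. integrable lborel (HM (d k) (g k) (h k) M) \<and> (\<integral>y. HM (d k) (g k) (h k) M y \<partial>lborel) \<le> B M)"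
    by (elim exE)
  then have g: "\<And>k. integrable lborel (g k)" and h: "\<And>k. integrable lborel (h k)"
    and cg: "\<And>k. AE x in lborel. x \<in> \<Omega> \<longrightarrow> u (e0 k) x = c k + primitive (g k) x"
    and dh: "\<And>k. AE x in lborel. x \<in> \<Omega> \<longrightarrow> v (e0 k) x = d k + primitive (h k) x"
    and HM: "\<And>k M. 0 \<le> M \<Longrightarrow> integrable lborel (HM (d k) (g k) (h k) M)"
      "\<And>k M. 0 \<le> M \<Longrightarrow> (\<integral>y. HM (d k) (g k) (h k) M y \<partial>lborel) \<le> B M"
    by simp_all
  define U where "U k x = c k + primitive (g k) x" for k x
  define V where "V k x = d k + primitive (h k) x" for k x
  have contU: "continuous_on UNIV (U k)" and contV: "continuous_on UNIV (V k)" for k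
    unfolding U_def[abs_def] V_def[abs_def]
    by (intro continuous_intros continuous_at_imp_continuous_on ballI isCont_primitive g h)+
  have HM0: "0 \<le> HM d g h M y" if "0 \<le> M" for d g h M y
    using that by (simp add: HM_def)
  have variation: "\<bar>cutoff (V k t) * \<tau> (U k t) - cutoff (V k s) * \<tau> (U k s)\<bar>
      \<le> primitive (HM (d k) (g k) (h k) M) t - primitive (HM (d k) (g k) (h k) M) s"
    if "\<And>x y. \<bar>\<tau> x - \<tau> y\<bar> \<le> \<bar>x - y\<bar>" "\<And>x. \<bar>\<tau> x\<bar> \<le> M" "s \<le> t" for \<tau> M s t k
    by (rule cutoff_product_variation[OF g h U_def V_def that(1,2) _ that(3)])
       (simp add: HM_def V_def)
  have bounded: "\<bar>cutoff (V k x) * \<tau> (U k x)\<bar> \<le> M" if "\<And>x. \<bar>\<tau> x\<bar> \<le> M" for \<tau> M k x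
    using mult_mono[OF cutoff_bounds(2)[of "V k x"] that[of "U k x"]] cutoff_bounds(1)[of "V k x"]
    by (simp add: abs_mult)

  have arctan_bound: "\<bar>arctan x\<bar> \<le> pi / 2" for x
    using arctan_lbound[of x] arctan_ubound[of x] by linarith
  obtain r Z where r: "strict_mono r"
    and Helly: "AE x in lborel. (\<lambda>n. cutoff (V (r n) x) * arctan (U (r n) x)) \<longlonglongrightarrow> Z x"
  proof (rule Helly_AE[of "\<lambda>k x. cutoff (V k x) * arctan (U k x)"
        "\<lambda>k. primitive (HM (d k) (g k) (h k) (pi / 2))" "pi / 2" "B (pi / 2)"])
    show "isCont (\<lambda>x. cutoff (V k x) * arctan (U k x)) x" for k x
    proof -
      have "continuous_on UNIV (\<lambda>x. cutoff (V k x) * arctan (U k x))"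
        by (intro continuous_intros contU contV)
      then show ?thesis by (simp add: continuous_on_eq_continuous_at)
    qed
    show "isCont (primitive (HM (d k) (g k) (h k) (pi / 2))) x" for k x
      by (intro isCont_primitive HM) simp
    show "\<bar>cutoff (V k x) * arctan (U k x)\<bar> \<le> pi / 2" for k x
      by (rule bounded[OF arctan_bound])
    show "\<bar>primitive (HM (d k) (g k) (h k) (pi / 2)) x\<bar> \<le> B (pi / 2)" for k x
    proof -
      have "0 \<le> primitive (HM (d k) (g k) (h k) (pi / 2)) x"
        by (rule primitive_bounds(1)[OF HM(1) HM0]) simp_all
      moreover have "primitive (HM (d k) (g k) (h k) (pi / 2)) x \<le> (\<integral>y. HM (d k) (g k) (h k) (pi / 2) y \<partial>lborel)"
        by (rule primitive_bounds(2)[OF HM(1) HM0]) simp_all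
      ultimately show ?thesis using HM(2)[of "pi / 2" k] by simp
    qed
    show "\<bar>cutoff (V k t) * arctan (U k t) - cutoff (V k s) * arctan (U k s)\<bar>
        \<le> primitive (HM (d k) (g k) (h k) (pi / 2)) t - primitive (HM (d k) (g k) (h k) (pi / 2)) s"
      if "s \<le> t" for k s t
      by (rule variation[OF abs_arctan_diff_le arctan_bound that])
  qed blast
  define e where "e k = e0 (r k)" for k
  have e: "0 < e k" for k by (simp add: e_def e0)
  have "e0 \<longlonglongrightarrow> 0" unfolding e0_def[abs_def] by (rule LIMSEQ_power_zero) simp
  then have e_lim: "e \<longlonglongrightarrow> 0"
    unfolding e_def[abs_def] using LIMSEQ_subseq_LIMSEQ[OF _ r] by (simp add: o_def)

  have v01: "AE x in lebesgue_on \<Omega>. v \<epsilon> x \<in> {0..1}"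
    and v_energy: "(\<integral>\<^sup>+x. ennreal (\<omega> (1 - v \<epsilon> x)) \<partial>lebesgue_on \<Omega>) \<le> ennreal (4 * \<epsilon> * C)" if "0 < \<epsilon>" for \<epsilon>
  proof -
    define E where "E x = phi_f \<phi> ell Q \<epsilon> (v \<epsilon> x) * (weak_deriv \<Omega> (u \<epsilon>) x)\<^sup>2
               + \<omega> (1 - v \<epsilon> x) / (4 * \<epsilon>) + \<epsilon> * (weak_deriv \<Omega> (v \<epsilon>) x)\<^sup>2" for x
    from pf[OF that] show v01: "AE x in lebesgue_on \<Omega>. v \<epsilon> x \<in> {0..1}"
      unfolding phase_field_def by (auto split: if_splits simp: top_unique)
    from pf[OF that] have E: "(\<integral>\<^sup>+x. ennreal (E x) \<partial>lebesgue_on \<Omega>) \<le> ennreal C"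
      unfolding phase_field_def E_def by (auto split: if_splits simp: top_unique)
    \<comment> \<open>The clamped potential is measurable, so the factor
      \<open>4 * \<epsilon>\<close> can leave its integral. Its comparison with the density
      \<open>E\<close> needs only a pointwise bound almost everywhere.\<close>
    define f where "f x = \<omega> (max 0 (min 1 (1 - v \<epsilon> x))) / (4 * \<epsilon>)" for x
    have "continuous_on UNIV (\<lambda>t. \<omega> (max 0 (min 1 (1 - t))) / (4 * \<epsilon>))"
      by (intro continuous_on_divide continuous_on_compose2[OF assms(12)] continuous_intros)
         (use that in auto)
    then have [measurable]: "f \<in> borel_measurable (lebesgue_on \<Omega>)"
      unfolding f_def[abs_def]
      using measurable_compose[OF v_meas[OF that] borel_measurable_continuous_onI] by blast
    have eq: "f x = \<omega> (1 - v \<epsilon> x) / (4 * \<epsilon>)" if "v \<epsilon> x \<in> {0..1}" for x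
      using that by (simp add: f_def)
    have "(\<integral>\<^sup>+x. ennreal (\<omega> (1 - v \<epsilon> x)) \<partial>lebesgue_on \<Omega>) = (\<integral>\<^sup>+x. ennreal (4 * \<epsilon>) * ennreal (f x) \<partial>lebesgue_on \<Omega>)"
    proof (rule nn_integral_cong_AE)
      show "AE x in lebesgue_on \<Omega>. ennreal (\<omega> (1 - v \<epsilon> x)) = ennreal (4 * \<epsilon>) * ennreal (f x)"
        using v01
      proof eventually_elim
        case (elim x)
        then show ?case using that by (simp add: eq ennreal_mult'[symmetric])
      qed
    qed
    also have "\<dots> = ennreal (4 * \<epsilon>) * (\<integral>\<^sup>+x. ennreal (f x) \<partial>lebesgue_on \<Omega>)"
      by (rule nn_integral_cmult) measurable
    also have "(\<integral>\<^sup>+x. ennreal (f x) \<partial>lebesgue_on \<Omega>) \<le> (\<integral>\<^sup>+x. ennreal (E x) \<partial>lebesgue_on \<Omega>)"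
    proof (rule nn_integral_mono_AE)
      show "AE x in lebesgue_on \<Omega>. ennreal (f x) \<le> ennreal (E x)"
        using v01
      proof eventually_elim
        case (elim x)
        have "0 \<le> phi_f \<phi> ell Q \<epsilon> (v \<epsilon> x)"
          by (rule phi_f_nonneg[OF _ L that]) (use assms(18) in auto)
        then have "f x \<le> E x" using that unfolding eq[OF elim] E_def by simp
        then show ?case by (rule ennreal_leI)
      qed
    qed
    also note E
    also have "ennreal (4 * \<epsilon>) * ennreal C = ennreal (4 * \<epsilon> * C)"
      using that C0 by (simp add: ennreal_mult)
    finally show "(\<integral>\<^sup>+x. ennreal (\<omega> (1 - v \<epsilon> x)) \<partial>lebesgue_on \<Omega>) \<le> ennreal (4 * \<epsilon> * C)"
      by (simp add: mult_left_mono)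
  qed
  have "AE x in lebesgue_on \<Omega>. (\<lambda>k. v (e0 k) x) \<longlonglongrightarrow> 1"
  proof (rule AE_phase_tendsto_1[OF assms(12) pos[OF assms(14,13)] \<omega>0 v_meas[OF e0] v01[OF e0] v_energy[OF e0]])
    show "summable (\<lambda>k. 4 * e0 k * C)"
      unfolding e0_def by (intro summable_mult summable_mult2 summable_geometric) simp
    show "0 \<le> 4 * e0 k * C" for k using e0[of k] C0 by simp
  qed
  then have v_lim: "AE x in lebesgue_on \<Omega>. (\<lambda>k. v (e k) x) \<longlonglongrightarrow> 1"
    by eventually_elim (use LIMSEQ_subseq_LIMSEQ[OF _ r] in \<open>simp add: o_def e_def\<close>)
  have rep: "AE x in lebesgue_on \<Omega>. \<forall>k. u (e k) x = U (r k) x \<and> v (e k) x = V (r k) x"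
    unfolding AE_all_countable AE_lebesgue_on_iff_lborel[OF \<Omega>(1)]
  proof
    fix k
    show "AE x in lborel. x \<in> \<Omega> \<longrightarrow> u (e k) x = U (r k) x \<and> v (e k) x = V (r k) x"
      using cg[of "r k"] dh[of "r k"] by eventually_elim (simp add: U_def V_def e_def)
  qed
  have fin: "AE x in lebesgue_on \<Omega>. liminf (\<lambda>k. ennreal \<bar>u (e k) x\<bar>) \<noteq> \<infinity>"
  proof (rule nn_integral_PInf_AE)
    note [measurable] = u_meas[OF e]
    show "(\<lambda>x. liminf (\<lambda>k. ennreal \<bar>u (e k) x\<bar>)) \<in> borel_measurable (lebesgue_on \<Omega>)" by measurable
    have "(\<integral>\<^sup>+x. liminf (\<lambda>k. ennreal \<bar>u (e k) x\<bar>) \<partial>lebesgue_on \<Omega>) \<le> liminf (\<lambda>k. L1_norm \<Omega> (u (e k)))"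
      unfolding L1_norm_def by (intro nn_integral_liminf) measurable
    also have "\<dots> \<le> ennreal C"
      by (rule Liminf_le) (use L1u[OF e] in auto)
    finally show "(\<integral>\<^sup>+x. liminf (\<lambda>k. ennreal \<bar>u (e k) x\<bar>) \<partial>lebesgue_on \<Omega>) \<noteq> \<infinity>"
      by (auto simp: top_unique)
  qed
  have cutoff_lim: "AE x in lebesgue_on \<Omega>. (\<lambda>k. cutoff (V (r k) x)) \<longlonglongrightarrow> 1"
    using rep v_lim
  proof eventually_elim
    case (elim x)
    then have "(\<lambda>k. V (r k) x) \<longlonglongrightarrow> 1" by simp
    moreover have "continuous_on UNIV cutoff" by (intro continuous_on_cutoff continuous_on_id)
    ultimately have "(\<lambda>k. cutoff (V (r k) x)) \<longlonglongrightarrow> cutoff 1"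
      by (intro continuous_on_tendsto_compose[of UNIV cutoff]) auto
    then show ?case by (simp add: cutoff_def)
  qed
  \<comment> \<open>Choosing \<open>lim\<close> at every point makes \<open>w\<close> measurable at
    once; its values where the sequence diverges form no obstacle, as these points turn out to be
    null.\<close>
  define w where "w x = lim (\<lambda>k. u (e k) x)" for x
  have w_meas: "w \<in> borel_measurable (lebesgue_on \<Omega>)"
    unfolding w_def[abs_def] by (intro borel_measurable_lim_metric u_meas e)
  have "AE x in lebesgue_on \<Omega>. (\<lambda>n. cutoff (V (r n) x) * arctan (U (r n) x)) \<longlonglongrightarrow> Z x"
    unfolding AE_lebesgue_on_iff_lborel[OF \<Omega>(1)] using Helly by eventually_elim simp
  with rep fin cutoff_lim have u_lim: "AE x in lebesgue_on \<Omega>. (\<lambda>k. u (e k) x) \<longlonglongrightarrow> w x"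
  proof eventually_elim
    case (elim x)
    \<comment> \<open>Dividing by the cutoff, which tends to 1, isolates the arctangent. The
      quotient is meaningful only once the cutoff is positive, hence the eventual equality
      below.\<close>
    have "(\<lambda>n. cutoff (V (r n) x) * arctan (U (r n) x) / cutoff (V (r n) x)) \<longlonglongrightarrow> Z x / 1"
      using elim(3,4) by (intro tendsto_divide) auto
    moreover have "\<forall>\<^sub>F n in sequentially. 0 < cutoff (V (r n) x)"
      using elim(3) by (rule order_tendstoD) simp
    then have "\<forall>\<^sub>F n in sequentially. cutoff (V (r n) x) * arctan (U (r n) x) / cutoff (V (r n) x) = arctan (u (e n) x)"
      by eventually_elim (use elim(1) in simp)
    ultimately have "(\<lambda>n. arctan (u (e n) x)) \<longlonglongrightarrow> Z x"
      by (simp cong: filterlim_cong)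
    from arctan_limit_imp_convergent[OF this elim(2)] have "(\<lambda>k. u (e k) x) \<longlonglongrightarrow> tan (Z x)" .
    then show ?case using limI by (force simp: w_def)
  qed
  have "w \<in> L1 \<Omega>"
    unfolding L1_def
  proof (intro CollectI integrableI_bounded w_meas)
    have "(\<integral>\<^sup>+x. ennreal \<bar>w x\<bar> * indicator \<Omega> x \<partial>lebesgue_on \<Omega>) \<le> ennreal C"
    proof (rule nn_integral_Fatou_bound[OF u_meas[OF e] _ _ u_lim])
      show "(\<integral>\<^sup>+x. ennreal \<bar>u (e k) x\<bar> * indicator \<Omega> x \<partial>lebesgue_on \<Omega>) \<le> ennreal C" for k
        using L1u[OF e[of k]] L1_norm_indicator[OF \<Omega>(2) \<Omega>(2)] by simp
    qed (use \<Omega>(2) in \<open>simp add: sets_restrict_space_iff\<close>)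
    then show "(\<integral>\<^sup>+x. ennreal (norm (w x)) \<partial>lebesgue_on \<Omega>) < \<infinity>"
      using L1_norm_indicator[OF \<Omega>(2) \<Omega>(2), of w]
      by (auto simp: L1_norm_def intro: order_le_less_trans)
  qed
  moreover have "w \<in> GBV \<Omega>"
    unfolding GBV_def
  proof (intro CollectI conjI allI impI w_meas)
    fix M :: real assume M: "0 < M"
    \<comment> \<open>The subsequence \<open>r\<close> and the limit \<open>w\<close> are already
      fixed and do not depend on \<open>M\<close>; only the variation bound \<open>B M\<close> does,
      which is all that membership in \<open>GBV\<close> requires.\<close>
    define T where "T t = max (- M) (min M t)" for t
    have T: "\<bar>T x - T y\<bar> \<le> \<bar>x - y\<bar>" "\<bar>T x\<bar> \<le> M" for x y
      using M by (auto simp: T_def max_def min_def abs_if)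
    have contT: "continuous_on A (\<lambda>x. T (f x))" if "continuous_on A f" for A and f :: "real \<Rightarrow> real"
      unfolding T_def using that by (intro continuous_intros)
    show "(\<lambda>x. max (- M) (min M (w x))) \<in> BV_loc \<Omega>"
      unfolding T_def[symmetric]
    proof (rule BV_loc_limit[where F = "\<lambda>k x. cutoff (V (r k) x) * T (U (r k) x)"
          and H = "\<lambda>k. HM (d (r k)) (g (r k)) (h (r k)) M" and M = M and C = "B M"])
      show "(\<lambda>x. T (w x)) \<in> borel_measurable (lebesgue_on \<Omega>)"
        unfolding T_def using w_meas by measurable
      show "integrable lborel (HM (d (r k)) (g (r k)) (h (r k)) M)"
        "(\<integral>y. HM (d (r k)) (g (r k)) (h (r k)) M y \<partial>lborel) \<le> B M" for k
        using HM M by simp_all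
      show "0 \<le> HM (d (r k)) (g (r k)) (h (r k)) M y" for k y using HM0 M by simp
      show "continuous_on UNIV (\<lambda>x. cutoff (V (r k) x) * T (U (r k) x))" for k
        by (intro continuous_intros contT contU contV)
      show "\<bar>cutoff (V (r k) x) * T (U (r k) x)\<bar> \<le> M" for k x by (rule bounded[OF T(2)])
      show "\<bar>cutoff (V (r k) t) * T (U (r k) t) - cutoff (V (r k) s) * T (U (r k) s)\<bar>
          \<le> primitive (HM (d (r k)) (g (r k)) (h (r k)) M) t - primitive (HM (d (r k)) (g (r k)) (h (r k)) M) s"
        if "s \<le> t" for k s t by (rule variation[OF T that])
      show "AE x in lborel. x \<in> \<Omega> \<longrightarrow> (\<lambda>k. cutoff (V (r k) x) * T (U (r k) x)) \<longlonglongrightarrow> T (w x)"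
        unfolding AE_lebesgue_on_iff_lborel[OF \<Omega>(1), symmetric]
        using rep u_lim cutoff_lim
      proof eventually_elim
        case (elim x)
        then have "(\<lambda>k. U (r k) x) \<longlonglongrightarrow> w x" by simp
        then have "(\<lambda>k. T (U (r k) x)) \<longlonglongrightarrow> T (w x)"
          unfolding T_def by (intro tendsto_intros)
        from tendsto_mult[OF elim(3) this] show ?case by simp
      qed
    qed (rule T(2))
  qed
  moreover have "(\<lambda>k. L1_norm \<Omega> (\<lambda>x. u (e k) x - w x)) \<longlonglongrightarrow> 0" if "equi_integrable \<Omega> {0<..} u"
    by (rule Vitali_L1[OF \<Omega>(3) that _ w_meas u_lim]) (simp add: e)
  moreover have "AE x in lebesgue_on \<Omega>. (\<lambda>k. u (e k) x) \<longlonglongrightarrow> w x \<and> (\<lambda>k. v (e k) x) \<longlonglongrightarrow> 1"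
    using u_lim v_lim by eventually_elim simp
  ultimately show ?thesis using e e_lim by blast
qed

end
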